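(* Let $N\ge 1$ be an integer, $\lambda,\mu>0$, and consider the $\Delta_{(i)}/G/1$ queue with $N$ customers, exponential arrival times of rate $\lambda$ and exponential service times of rate $\mu$. Put $\lambda_n=\lambda(N-n)$ and $\rho_n=\mu/(\mu+\lambda_n)$ for $1\le n\le N$. For $1\le i\le N$ let $s_i=\mathbb P(S=i)$ be the probability that exactly $i$ customers are served in the first busy period; equivalently, $s_i$ is the probability that the Dyck path traced by the embedded Markov chain started at $(0,0)$ hits the diagonal, after time $0$, for the first time at $(i,i)$. Then $$s_i=\sum_{(u_1,\ldots,u_i)\in\mathcal U_i} b(\rho_1^{u_1},\rho_2^{u_2},\ldots,\rho_i^{u_i})\,\rho_1^{u_1}\rho_2^{u_2}\cdots\rho_i^{u_i},$$ where $\mathcal U_i$ is the set of feasible allocations of length $i$ and $b$ is the explicit real-valued function defined in the context, which takes both positive and negative values; here the vector $(\rho_1^{u_1},\ldots,\rho_i^{u_i})$ is indexed by $1<2<\cdots<i$.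
   Context: **Queue.** There is a single server and a pool of $N$ customers. Each customer joins the queue exactly once, at an exponential time of rate $\lambda$; service times are exponential of rate $\mu$; all these variables are independent; service is first-come first-served, and served customers leave permanently. Let $X(t)=(X_1(t),X_2(t))$, where $X_1(t)$ is the number of completed services and $X_2(t)$ the number of arrivals up to time $t$, with $X(0)=(0,0)$. This is a Markov process on $\{(i,j)\in\mathbb Z^2: 0\le i\le j\le N\}$, with transitions $(i,j)\to(i,j+1)$ at rate $\lambda_j=\lambda(N-j)$ (for $j<N$) and $(i,j)\to(i+1,j)$ at rate $\mu$ (for $i<j$). The first busy period is the time between the instant the first customer arrives (to the empty system) and the first subsequent instant at which a departing customer leaves behind an empty system; $S$ is the number of customers served in it. **Embedded chain.** The embedded Markov chain $(X(k))_{k=0}^{2N}$ starts at $(0,0)$. From $(i,j)$ with $i<j$ it moves to $(i+1,j)$ with probability $\rho_j$ and to $(i,j+1)$ with probability $1-\rho_j$. From $(i,i)$ with $i<N$ it moves to $(i,i+1)$ with probability one. Its trajectory is a Dyck path of order $N$, that is, a staircase walk from $(0,0)$ to $(N,N)$ with unit up and right steps that stays above (but may touch) the diagonal. **Feasible allocations.** $\mathcal U_n$ is the set of vectors $(u_1,\ldots,u_n)$ of nonnegative integers with $\sum_{j=1}^n u_j=n$ defined recursively as follows: $u_1\in\{0,1\}$; if $u_{j-1}\ne0$ then $u_j\in\{0,1\}$; and if $u_j$ is preceded by a maximal run of exactly $k-1$ zeros, then $u_j\in\{0,k\}$. Equivalently, these are the Dyck paths of order $n$, with $u_j$ right steps at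 height $j$, that hit the diagonal whenever they jump to the right. **Function $b$.** Let $\boldsymbol a=(a_{k_1},\ldots,a_{k_n})\in(\mathbb R^+)^n$ be a vector indexed by $k_1<k_2<\cdots<k_n$. Let $M=M(\boldsymbol a)=\sum_{j=1}^n \mathbf 1\{a_{k_j}\ne 1\}$ be the number of entries of $\boldsymbol a$ that are not equal to one, and let $k_{(1)}<k_{(2)}<\cdots<k_{(M)}$ be the ordered indices of those entries. Put $k_{(0)}=k_1$ and $k_{(M+1)}=k_n$. Then $$b(a_{k_1},\ldots,a_{k_n})=(-1)^{M-1}\prod_{m=0}^{M}\ \prod_{k=k_{(m)}}^{k_{(m+1)}-1}\frac{\lambda_k}{\lambda_k-\lambda_{k_{(m+1)}}},$$ with empty products equal to $1$. For $\lambda_n=\lambda(N-n)$ this equals $(-1)^{M-1}\prod_{m=0}^{M}\binom{N-k_{(m)}}{k_{(m+1)}-k_{(m)}}$.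
   Formalization: At i = N the printed formula gives −s_N (since ρ_N = 1), so there ρ_j^{u_j} is counted in M as different from one exactly when u_j ≠ 0; for i < N, b is used as printed; the remark that b takes both positive and negative values is not part of the theorem. *)

theory Defs
  imports "HOL-Probability.Probability"
begin

definition arr_rate :: "nat \<Rightarrow> real \<Rightarrow> nat \<Rightarrow> real" where
  "arr_rate N lam n = lam * (real N - real n)"

definition rho :: "nat \<Rightarrow> real \<Rightarrow> real \<Rightarrow> nat \<Rightarrow> real" where
  "rho N lam mu n = mu / (mu + arr_rate N lam n)"

text \<open>
  A sample point is given by the arrival times \<open>T 1, \<dots>, T N\<close> of the customers (in no particular
  order) and the service times \<open>V 1, \<dots>, V N\<close>, where \<open>V k\<close> is the service time of the
  \<open>k\<close>-th customer to be served.  The system is empty at time 0.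
\<close>

definition arrival_epoch :: "nat \<Rightarrow> (nat \<Rightarrow> real) \<Rightarrow> nat \<Rightarrow> real" where
  "arrival_epoch N T k = sort (map T [1..<Suc N]) ! (k - 1)"

text \<open>First-come first-served with a single server (Lindley recursion); index 0 is the
  opening time of the system.\<close>

fun departure_epoch :: "nat \<Rightarrow> (nat \<Rightarrow> real) \<Rightarrow> (nat \<Rightarrow> real) \<Rightarrow> nat \<Rightarrow> real" where
  "departure_epoch N T V 0 = 0"
| "departure_epoch N T V (Suc k) =
     max (departure_epoch N T V k) (arrival_epoch N T (Suc k)) + V (Suc k)"

definition num_served :: "nat \<Rightarrow> (nat \<Rightarrow> real) \<Rightarrow> (nat \<Rightarrow> real) \<Rightarrow> real \<Rightarrow> nat" where
  "num_served N T V t = card {k \<in> {1..N}. departure_epoch N T V k \<le> t}"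

definition num_arrived :: "nat \<Rightarrow> (nat \<Rightarrow> real) \<Rightarrow> real \<Rightarrow> nat" where
  "num_arrived N T t = card {j \<in> {1..N}. T j \<le> t}"

text \<open>The end of the first busy period is the first departure epoch at which the system is left
  empty.  All services completed by then belong to the first busy period.\<close>

definition first_busy_end :: "nat \<Rightarrow> (nat \<Rightarrow> real) \<Rightarrow> (nat \<Rightarrow> real) \<Rightarrow> real" where
  "first_busy_end N T V =
     Min {t \<in> departure_epoch N T V ` {1..N}. num_served N T V t = num_arrived N T t}"

definition first_busy_served :: "nat \<Rightarrow> (nat \<Rightarrow> real) \<Rightarrow> (nat \<Rightarrow> real) \<Rightarrow> nat" where
  "first_busy_served N T V = num_served N T V (first_busy_end N T V)"

text \<open>A state \<open>(i, j)\<close> records \<open>i\<close> completed services and \<open>j\<close> arrivals.  Since \<open>rho N lam mu N = 1\<close>,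
  the coordinate \<open>j\<close> never exceeds \<open>N\<close>; the chain is at \<open>(N, N)\<close> after \<open>2 * N\<close> steps.\<close>

fun chain_step :: "nat \<Rightarrow> real \<Rightarrow> real \<Rightarrow> nat \<times> nat \<Rightarrow> (nat \<times> nat) pmf" where
  "chain_step N lam mu (i, j) =
     (if i < j then
        map_pmf (\<lambda>served. if served then (Suc i, j) else (i, Suc j))
          (bernoulli_pmf (rho N lam mu j))
      else if j < N then return_pmf (i, Suc j)
      else return_pmf (i, j))"

primrec chain_path :: "nat \<Rightarrow> real \<Rightarrow> real \<Rightarrow> nat \<Rightarrow> (nat \<times> nat) list pmf" where
  "chain_path N lam mu 0 = return_pmf [(0, 0)]"
| "chain_path N lam mu (Suc k) =
     bind_pmf (chain_path N lam mu k)
       (\<lambda>xs. map_pmf (\<lambda>x. xs @ [x]) (chain_step N lam mu (last xs)))"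

definition first_return_at :: "nat \<Rightarrow> (nat \<times> nat) list \<Rightarrow> bool" where
  "first_return_at i xs \<longleftrightarrow>
     (\<exists>k. 0 < k \<and> k < length xs \<and> xs ! k = (i, i) \<and>
          (\<forall>l. 0 < l \<and> l < k \<longrightarrow> fst (xs ! l) \<noteq> snd (xs ! l)))"

text \<open>\<open>zero_run u j\<close> is the length of the maximal run of zeros among the entries
  \<open>u 1, \<dots>, u (j - 1)\<close> that ends at index \<open>j - 1\<close> (it is 0 if \<open>j = 1\<close> or \<open>u (j - 1) \<noteq> 0\<close>).\<close>

fun zero_run :: "(nat \<Rightarrow> nat) \<Rightarrow> nat \<Rightarrow> nat" where
  "zero_run u 0 = 0"
| "zero_run u (Suc j) = (if 1 \<le> j \<and> u j = 0 then Suc (zero_run u j) else 0)"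

definition feasible_allocations :: "nat \<Rightarrow> (nat \<Rightarrow> nat) set" where
  "feasible_allocations n =
     {u \<in> {1..n} \<rightarrow>\<^sub>E UNIV. (\<Sum>j=1..n. u j) = n \<and>
        (\<forall>j\<in>{1..n}. u j \<in> {0, zero_run u j + 1})}"

text \<open>
  For a finite nonempty index set \<open>K\<close> and \<open>J \<subseteq> K\<close>, the list \<open>b_nodes K J\<close> is
  \<open>[k(0), k(1), \<dots>, k(M), k(M+1)]\<close>, where \<open>k(1) < \<dots> < k(M)\<close> are the elements of \<open>J\<close>,
  \<open>k(0) = Min K\<close> and \<open>k(M+1) = Max K\<close>.
\<close>

definition b_nodes :: "nat set \<Rightarrow> nat set \<Rightarrow> nat list" where
  "b_nodes K J = Min K # sorted_list_of_set J @ [Max K]"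

text \<open>The value of \<open>b\<close> on a vector indexed by \<open>K\<close> in which precisely the entries with index in
  \<open>J\<close> are counted as different from one; \<open>l\<close> is the sequence of arrival rates.\<close>

definition b_marked :: "(nat \<Rightarrow> real) \<Rightarrow> nat set \<Rightarrow> nat set \<Rightarrow> real" where
  "b_marked l K J =
     (-1) powi (int (card J) - 1) *
     (\<Prod>m=0..card J. \<Prod>k=b_nodes K J ! m ..< b_nodes K J ! (m + 1).
        l k / (l k - l (b_nodes K J ! (m + 1))))"

definition b_fun :: "(nat \<Rightarrow> real) \<Rightarrow> nat set \<Rightarrow> (nat \<Rightarrow> real) \<Rightarrow> real" where
  "b_fun l K a = b_marked l K {k \<in> K. a k \<noteq> 1}"

text \<open>
  The entry \<open>rho j ^ u j\<close> is to be counted as different from one iff \<open>u j \<noteq> 0\<close>.  For \<open>j < N\<close> this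
  is the same as being numerically different from one, because \<open>0 < rho j < 1\<close>.  For \<open>j = N\<close> it is
  not: \<open>rho N = 1\<close> as a number, while \<open>u N \<noteq> 0\<close> for every feasible allocation of length \<open>N\<close>.
  Applying \<open>b_fun\<close> to the numerical vector of length \<open>N\<close> would therefore miscount \<open>M\<close> by one
  and flip the sign (for \<open>N = 1\<close> it would give the probability \<open>-1\<close>).
\<close>

definition b_powers :: "(nat \<Rightarrow> real) \<Rightarrow> nat \<Rightarrow> (nat \<Rightarrow> nat) \<Rightarrow> real" where
  "b_powers l n u = b_marked l {1..n} {j \<in> {1..n}. u j \<noteq> 0}"

end

theory Submission
  imports Defs
begin

text \<open>
  By the memorylessness of exponential clocks, the probability that the first busy period serves
  \<open>i\<close> customers solves the same first-step equations as the probability that the embedded chain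
  first returns to the diagonal at \<open>(i, i)\<close>. Call it \<open>q i\<close>. For every \<open>b\<close>
  the function \<open>(k, j) \<mapsto> binomial(N - j, b - j) * rho b ^ (b - k)\<close> is harmonic for the embedded
  chain above the diagonal. Evaluating it at \<open>(0, 1)\<close> and at the first return gives
  \<open>binomial(N - 1, b - 1) * rho b ^ b = (\<Sum>i=1..b. q i * binomial(N - i, b - i) * rho b ^ (b - i))\<close>,
  a triangular system that determines \<open>q\<close>. A feasible allocation of length \<open>b\<close> is determined by its
  set of nonzero indices, which contains \<open>b\<close>; splitting the sum over allocations by the
  preceding nonzero index shows that it solves the same system.
\<close>

text \<open>The terms of the formula have both signs, so they cannot be probabilities of paths, and
  no bijection between paths and allocations is sought: the harmonic functions eliminate the paths.
  The weights in them are forced. If a function of this shape is to be harmonic, the ratio of its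
  weights at two consecutive heights is determined, and these ratios are the factors in the
  definition of the function \<open>b\<close>. The signs come from solving the triangular system for
  its last unknown: each further nonzero index is one more substitution of an earlier unknown, hence
  one more minus sign, which produces the power of -1. The queue and the chain are not coupled; each
  is compared with the deterministic recursion \<open>hit\<close>. For the queue, a state has to
  name the customers still to arrive, and only their number matters in the end. The start is special
  on both sides: \<open>(0, 0)\<close> itself lies on the diagonal, and in an empty system no
  service clock runs. Both comparisons therefore begin at \<open>(0, 1)\<close>.\<close>

subsection \<open>Hitting the diagonal\<close>

text \<open>The expected value of \<open>g l\<close> when the chain started at \<open>(k, j)\<close>, with service
  probabilities \<open>r\<close>, first reaches the diagonal at \<open>(l, l)\<close>.\<close>
function hit :: "nat \<Rightarrow> (nat \<Rightarrow> real) \<Rightarrow> (nat \<Rightarrow> real) \<Rightarrow> nat \<Rightarrow> nat \<Rightarrow> real" where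
  "hit N r g k j =
     (if k < j then r j * hit N r g (Suc k) j + (1 - r j) * (if j < N then hit N r g k (Suc j) else 0)
      else g j)"
  by pat_completeness auto
text \<open>A service lowers \<open>j - k\<close> by one; an arrival raises it by one, hence the
  factor 2 in front of \<open>N - j\<close>. The 0 that the equation substitutes at
  \<open>j = N\<close> is harmless once \<open>r N = 1\<close>.\<close>

termination by (relation "Wellfounded.measure (\<lambda>(N, r, g, k, j). 2 * (N - j) + (j - k))") auto

declare hit.simps [simp del]

lemma hit_diag [simp]: "hit N r g j j = g j"
  by (subst hit.simps) simp

lemma hit_step:
  "k < j \<Longrightarrow> j < N \<Longrightarrow> hit N r g k j = r j * hit N r g (Suc k) j + (1 - r j) * hit N r g k (Suc j)"
  by (subst hit.simps) simp

lemma hit_step_full: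
  "k < N \<Longrightarrow> r N = 1 \<Longrightarrow> hit N r g k N = hit N r g (Suc k) N"
  by (subst hit.simps) simp

text \<open>Induction along the moves of the chain, on the measure that makes \<open>hit\<close>
  terminate; on or below the diagonal no hypothesis is available.\<close>

lemma lattice_induct [case_names step]:
  fixes k j N :: nat
  assumes "\<And>k j. (k < j \<Longrightarrow> P (Suc k) j) \<Longrightarrow> (k < j \<Longrightarrow> j < N \<Longrightarrow> P k (Suc j)) \<Longrightarrow> P k j"
  shows "P k j"
proof (induction "2 * (N - j) + (j - k)" arbitrary: k j rule: less_induct)
  case less
  show ?case by (rule assms; rule less; simp)
qed

lemma hit_cong:
  assumes "\<And>l. l \<ge> j \<Longrightarrow> g l = g' l"
  shows "hit N r g k j = hit N r g' k j"
  using assms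
proof (induction k j rule: lattice_induct[where N = N])
  case (step k j)
  then show ?case by (subst (1 2) hit.simps) simp
qed

lemma hit_zero: "hit N r (\<lambda>_. 0) k j = 0"
proof (induction k j rule: lattice_induct[where N = N])
  case (step k j)
  then show ?case by (subst hit.simps) simp
qed

text \<open>Every move leads closer to the diagonal, so a harmonic function has no freedom beyond
  its values there. This is optional stopping at the first return, stated without a process.\<close>

lemma hit_unique:
  assumes rN: "r N = 1"
    and harm: "\<And>k j. k < j \<Longrightarrow> j \<le> N \<Longrightarrow>
           h k j = r j * h (Suc k) j + (1 - r j) * h k (Suc j)"
    and "k \<le> j" "j \<le> N"
  shows "h k j = hit N r (\<lambda>l. h l l) k j"
  using assms(3,4)
proof (induction k j rule: lattice_induct[where N = N])
  case (step k j)
  show ?case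
  proof (cases "k < j")
    case True
    then have 1: "h (Suc k) j = hit N r (\<lambda>l. h l l) (Suc k) j"
      using step by simp
    show ?thesis
    proof (cases "j = N")
      \<comment> \<open>\<open>h k (Suc N)\<close> lies outside the lattice and is unconstrained,
        but its coefficient \<open>1 - r N\<close> is 0.\<close>
      case j: True
      then show ?thesis
        using 1 harm[OF True step.prems(2)] hit_step_full[of k N r, OF _ rN] True rN by simp
    next
      case False
      then have "j < N" using step.prems by simp
      moreover from this have "h k (Suc j) = hit N r (\<lambda>l. h l l) k (Suc j)"
        using step True by simp
      ultimately show ?thesis
        using 1 harm[OF True step.prems(2)] hit_step[OF True] by simp
    qed
  qed (use step.prems in simp)
qed

lemma hit_sum:
  shows "hit N r (\<lambda>l. \<Sum>i\<in>A. c i * g i l) k j = (\<Sum>i\<in>A. c i * hit N r (g i) k j)"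
proof (induction k j rule: lattice_induct[where N = N])
  case (step k j)
  show ?case
    using step by (subst (1 2) hit.simps)
      (simp add: sum_distrib_left sum.distrib [symmetric] algebra_simps)
qed

section \<open>Weights between nodes and the harmonic functions built from them\<close>

text \<open>The factor that two consecutive nodes \<open>a \<le> b\<close> contribute to \<open>b_marked\<close>.\<close>
definition rate_weight :: "(nat \<Rightarrow> real) \<Rightarrow> nat \<Rightarrow> nat \<Rightarrow> real" where
  "rate_weight l a b = (\<Prod>k=a..<b. l k / (l k - l b))"

lemma rate_weight_self [simp]: "rate_weight l b b = 1"
  by (simp add: rate_weight_def)

lemma rate_weight_rec: "a < b \<Longrightarrow> rate_weight l a b = l a / (l a - l b) * rate_weight l (Suc a) b"
  by (simp add: rate_weight_def prod.atLeast_Suc_lessThan)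

context
  fixes N :: nat and lam mu :: real
  assumes lam: "lam > 0" and mu: "mu > 0"
begin

lemma arr_rate_strict: "a < b \<Longrightarrow> arr_rate N lam a > arr_rate N lam b"
  using lam by (simp add: arr_rate_def)

lemma arr_rate_nonneg: "a \<le> N \<Longrightarrow> arr_rate N lam a \<ge> 0"
  using lam by (simp add: arr_rate_def)

lemma rho_full [simp]: "rho N lam mu N = 1"
  using mu by (simp add: rho_def arr_rate_def)

lemma rho_bounds: "j \<le> N \<Longrightarrow> rho N lam mu j \<in> {0..1}"
  using mu arr_rate_nonneg[of j] by (simp add: rho_def)

lemma rho_lt_1: "j < N \<Longrightarrow> 0 < rho N lam mu j \<and> rho N lam mu j < 1"
  using mu arr_rate_strict[of j N] arr_rate_nonneg[of N] by (simp add: rho_def)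

text \<open>Up to common factors this is an identity between rates. Solved for the ratio of the
  weights at \<open>j\<close> and \<open>j + 1\<close>, it gives
  \<open>(1 - rho j) * rho b / (rho b - rho j)\<close>, which for
  \<open>rho = mu / (mu + rate)\<close> is \<open>x / (x - y)\<close> with the rates
  \<open>x\<close> at \<open>j\<close> and \<open>y\<close> at \<open>b\<close>.\<close>

lemma weight_harmonic:
  assumes "k < j" "j < b" "b \<le> N"
  shows "rate_weight (arr_rate N lam) j b * rho N lam mu b ^ (b - k) =
     rho N lam mu j * (rate_weight (arr_rate N lam) j b * rho N lam mu b ^ (b - Suc k)) +
     (1 - rho N lam mu j) * (rate_weight (arr_rate N lam) (Suc j) b * rho N lam mu b ^ (b - k))"
proof -
  define x y where "x = arr_rate N lam j" and "y = arr_rate N lam b"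
  have xy: "x > y" "y \<ge> 0"
    using assms arr_rate_strict[of j b] arr_rate_nonneg[of b] by (auto simp: x_def y_def)
  have b: "b - k = Suc (b - Suc k)" using assms by simp
  define W where "W = rate_weight (arr_rate N lam) (Suc j) b"
  have W: "rate_weight (arr_rate N lam) j b = x / (x - y) * W"
    using assms by (simp add: rate_weight_rec x_def y_def W_def)
  define P where "P = rho N lam mu b ^ (b - Suc k)"
  have r: "rho N lam mu j = mu / (mu + x)" "rho N lam mu b = mu / (mu + y)"
    by (simp_all add: rho_def x_def y_def)
  have key: "x / (x - y) * (mu / (mu + y)) =
    mu / (mu + x) * (x / (x - y)) + (1 - mu / (mu + x)) * (mu / (mu + y))"
  proof -
    have "x - y \<noteq> 0" "mu + y \<noteq> 0" "mu + x \<noteq> 0" using xy mu by auto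
    then show ?thesis by (simp add: divide_simps) (simp add: algebra_simps)
  qed
  have "x / (x - y) * W * (mu / (mu + y) * P) = (x / (x - y) * (mu / (mu + y))) * (W * P)"
    by simp
  also have "\<dots> = mu / (mu + x) * (x / (x - y) * W * P) + (1 - mu / (mu + x)) * (W * (mu / (mu + y) * P))"
    unfolding key by (simp only: distrib_right distrib_left mult_ac)
  finally show ?thesis
    unfolding b W power_Suc r(1) r(2)[symmetric] P_def[symmetric] W_def[symmetric] by (simp only: r P_def)
qed

text \<open>For \<open>rate_weight\<close> equal to a binomial coefficient, both sides count, in expectation, the sets
  of \<open>b\<close> customers containing the first one such that nobody outside the set arrives during the
  first \<open>b\<close> services; on the right the count is split according to the first busy period.\<close>
lemma hit_weight_identity:
  assumes "1 \<le> b" "b \<le> N"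
  shows "rate_weight (arr_rate N lam) 1 b * rho N lam mu b ^ b =
    (\<Sum>i=1..b. hit N (rho N lam mu) (\<lambda>l. of_bool (l = i)) 0 1 *
               rate_weight (arr_rate N lam) i b * rho N lam mu b ^ (b - i))"
proof -
  \<comment> \<open>The function is cut off above height \<open>b\<close>. It stays harmonic at
    \<open>j = b\<close>, where \<open>h k b = rho b * h (k + 1) b\<close> leaves no room for an
    arrival term; the cut makes the sum over first returns end at \<open>b\<close>.\<close>
  define h where "h k j = (if j \<le> b then rate_weight (arr_rate N lam) j b * rho N lam mu b ^ (b - k) else 0)" for k j
  have "h 0 1 = hit N (rho N lam mu) (\<lambda>l. h l l) 0 1"
  proof (rule hit_unique)
    fix k j assume kj: "k < j" "j \<le> N"
    consider "j < b" | "j = b" | "j > b" by linarith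
    then show "h k j = rho N lam mu j * h (Suc k) j + (1 - rho N lam mu j) * h k (Suc j)"
    proof cases
      case 1
      then show ?thesis using weight_harmonic[OF kj(1) 1 assms(2)] by (simp add: h_def)
    next
      case 2
      then have "b - k = Suc (b - Suc k)" using kj by simp
      then show ?thesis using 2 by (simp add: h_def)
    qed (simp add: h_def)
  qed (use assms in auto)
  \<comment> \<open>From \<open>(0, 1)\<close> the diagonal is reached only at some
    \<open>l \<ge> 1\<close>, and \<open>h l l\<close> is 0 for \<open>l > b\<close>; so indicators
    of the points \<open>1, ..., b\<close> suffice as boundary values.\<close>
  also have "\<dots> = hit N (rho N lam mu) (\<lambda>l. \<Sum>i=1..b. h i i * of_bool (l = i)) 0 1"
    by (rule hit_cong) (auto simp: h_def of_bool_def if_distrib sum.delta cong: if_cong)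
  also have "\<dots> = (\<Sum>i=1..b. h i i * hit N (rho N lam mu) (\<lambda>l. of_bool (l = i)) 0 1)"
    by (rule hit_sum)
  finally show ?thesis
    using assms by (simp add: h_def mult_ac)
qed

end

subsection \<open>Feasible allocations\<close>

lemma zero_run_le: "zero_run u j \<le> j - 1"
  by (induction j) auto

lemma zero_run_after:
  assumes "a = 0 \<or> u a \<noteq> 0" "\<And>k. a < k \<Longrightarrow> k < j \<Longrightarrow> u k = 0" "a < j"
  shows "zero_run u j = j - Suc a"
  using assms by (induction j) (auto simp: less_Suc_eq Suc_diff_Suc)

text \<open>The only feasible way to prolong \<open>u\<close> so that the next nonzero index after
  \<open>a\<close> is \<open>b\<close>: the \<open>b - a - 1\<close> zeros in between force the
  entry \<open>b - a\<close>.\<close>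

definition extend_alloc :: "nat \<Rightarrow> nat \<Rightarrow> (nat \<Rightarrow> nat) \<Rightarrow> nat \<Rightarrow> nat" where
  "extend_alloc a b u = (\<lambda>j\<in>{1..b}. if j \<le> a then u j else if j = b then b - a else 0)"

text \<open>Each nonzero entry counts its own index and the zeros directly before it, so only
  trailing zeros stay uncounted. Hence the condition on the total says that the last entry is
  nonzero.\<close>

lemma feasible_last_nonzero:
  assumes "\<And>j. j \<in> {1..n} \<Longrightarrow> u j \<in> {0, zero_run u j + 1}"
  shows "(\<Sum>j=1..n. u j) + zero_run u (Suc n) = n"
  using assms
proof (induction n)
  case (Suc n)
  then have "(\<Sum>j=1..n. u j) + zero_run u (Suc n) = n" by simp
  moreover have "u (Suc n) \<in> {0, zero_run u (Suc n) + 1}" using Suc.prems[of "Suc n"] by simp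
  ultimately show ?case by (auto simp del: zero_run.simps(2) simp: zero_run.simps(2)[of u "Suc n"])
qed simp

lemma feasible_alt:
  "u \<in> feasible_allocations n \<longleftrightarrow>
     u \<in> {1..n} \<rightarrow>\<^sub>E UNIV \<and> (\<forall>j\<in>{1..n}. u j \<in> {0, zero_run u j + 1}) \<and> (n = 0 \<or> u n \<noteq> 0)"
proof -
  have "(\<Sum>j=1..n. u j) = n \<longleftrightarrow> n = 0 \<or> u n \<noteq> 0" if "\<forall>j\<in>{1..n}. u j \<in> {0, zero_run u j + 1}"
    using feasible_last_nonzero[of n u] that by (cases n) (auto split: if_splits)
  then show ?thesis by (auto simp: feasible_allocations_def)
qed

lemma feasible_0: "feasible_allocations 0 = {\<lambda>_. undefined}"
  by (auto simp: feasible_allocations_def)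

lemma extend_alloc_feasible:
  assumes u: "u \<in> feasible_allocations a" and ab: "a < b"
  shows "extend_alloc a b u \<in> feasible_allocations b"
proof -
  let ?v = "extend_alloc a b u"
  have nz: "a = 0 \<or> u a \<noteq> 0" and f: "\<forall>j\<in>{1..a}. u j \<in> {0, zero_run u j + 1}"
    using u by (auto simp: feasible_alt)
  have "?v j \<in> {0, zero_run ?v j + 1}" if j: "j \<in> {1..b}" for j
  proof (cases "j \<le> a")
    case True
    then have "zero_run ?v j = zero_run u j"
    proof -
      have "zero_run ?v j' = zero_run u j'" if "j' \<le> a" for j'
        using that ab by (induction j') (auto simp: extend_alloc_def)
      then show ?thesis using True by blast
    qed
    then show ?thesis using f True j ab by (simp add: extend_alloc_def)
  next
    case False
    show ?thesis
    proof (cases "j = b")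
      case True
      have "zero_run ?v b = b - Suc a"
        using nz ab by (intro zero_run_after) (auto simp: extend_alloc_def)
      then show ?thesis using True ab by (simp add: extend_alloc_def)
    qed (use False j in \<open>simp add: extend_alloc_def\<close>)
  qed
  then show ?thesis using ab by (simp add: feasible_alt) (simp add: extend_alloc_def)
qed

lemma feasible_decompose:
  assumes v: "v \<in> feasible_allocations b" and b: "b \<ge> 1"
  shows "\<exists>a<b. \<exists>u\<in>feasible_allocations a. v = extend_alloc a b u"
proof -
  \<comment> \<open>Walking back from \<open>b - 1\<close> over the run of zeros ends at the
    preceding nonzero index, or at 0 if there is none.\<close>
  define a where "a = b - 1 - zero_run v b"
  have f: "\<And>j. j \<in> {1..b} \<Longrightarrow> v j \<in> {0, zero_run v j + 1}" and ext: "v \<in> {1..b} \<rightarrow>\<^sub>E UNIV" and nz: "v b \<noteq> 0"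
    using v b by (auto simp: feasible_alt)
  have run: "(\<forall>k. a < k \<and> k < b \<longrightarrow> v k = 0) \<and> (a = 0 \<or> v a \<noteq> 0)"
  proof -
    have "(\<forall>k. j - 1 - zero_run v j < k \<and> k < j \<longrightarrow> v k = 0) \<and>
       (j - 1 - zero_run v j = 0 \<or> v (j - 1 - zero_run v j) \<noteq> 0)" for j
    proof (induction j)
      case (Suc j)
      show ?case
        using Suc zero_run_le[of v j] by (auto simp: less_Suc_eq)
    qed simp
    from this[of b] show ?thesis by (simp add: a_def)
  qed
  have ab: "a < b" and zr: "zero_run v b = b - Suc a"
    using b zero_run_le[of v b] by (auto simp: a_def)
  let ?u = "restrict v {1..a}"
  have "?u \<in> feasible_allocations a"
  proof -
    have "zero_run ?u j = zero_run v j" if "j \<le> a" for j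
      using that by (induction j) auto
    then show ?thesis using f run ab by (auto simp: feasible_alt)
  qed
  moreover have "v = extend_alloc a b ?u"
  proof
    fix j
    show "v j = extend_alloc a b ?u j"
      using ext f[of b] nz zr run ab b by (cases "j \<in> {1..b}") (auto simp: extend_alloc_def PiE_def extensional_def)
  qed
  ultimately show ?thesis using ab by blast
qed

lemma extend_alloc_inj:
  assumes "u \<in> feasible_allocations a" "u' \<in> feasible_allocations a'" "a < b" "a' < b"
    "extend_alloc a b u = extend_alloc a' b u'"
  shows "a = a' \<and> u = u'"
proof -
  have "extend_alloc a b u b = extend_alloc a' b u' b" using assms(5) by simp
  then have aa: "a = a'" using assms(3,4) by (simp add: extend_alloc_def)
  moreover have "u j = u' j" for j
  proof (cases "j \<in> {1..a}")
    case True
    have "extend_alloc a b u j = extend_alloc a' b u' j" using assms(5) by simp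
    then show ?thesis using True aa assms(3,4) by (simp add: extend_alloc_def)
  next
    case False
    then show ?thesis using assms(1,2) aa by (auto simp: feasible_alt PiE_def extensional_def)
  qed
  ultimately show ?thesis by auto
qed

lemma finite_feasible: "finite (feasible_allocations n)"
proof -
  have "feasible_allocations n \<subseteq> {1..n} \<rightarrow>\<^sub>E {..n}"
  proof
    fix u assume u: "u \<in> feasible_allocations n"
    have "u j \<le> n" if "j \<in> {1..n}" for j
    proof -
      have "u j \<le> zero_run u j + 1" using u that by (force simp: feasible_alt)
      then show ?thesis using zero_run_le[of u j] that unfolding atLeastAtMost_iff by linarith
    qed
    then show "u \<in> {1..n} \<rightarrow>\<^sub>E {..n}" using u by (auto simp: feasible_alt PiE_def Pi_def)
  qed
  then show ?thesis by (rule finite_subset) (auto intro: finite_PiE)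
qed

text \<open>Grouping by the last nonzero index before \<open>b\<close>; \<open>a = 0\<close> stands
  for its absence, with the empty allocation as the only one to extend.\<close>

lemma sum_feasible:
  assumes "b \<ge> 1"
  shows "(\<Sum>v\<in>feasible_allocations b. f v) =
    (\<Sum>a<b. \<Sum>u\<in>feasible_allocations a. f (extend_alloc a b u) :: real)"
proof -
  have "(\<Sum>a<b. \<Sum>u\<in>feasible_allocations a. f (extend_alloc a b u)) =
        (\<Sum>(a, u)\<in>Sigma {..<b} feasible_allocations. f (extend_alloc a b u))"
    by (rule sum.Sigma) (auto simp: finite_feasible)
  also have "\<dots> = (\<Sum>v\<in>feasible_allocations b. f v)"
  proof -
    have "bij_betw (\<lambda>x. extend_alloc (fst x) b (snd x)) (Sigma {..<b} feasible_allocations) (feasible_allocations b)"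
      unfolding bij_betw_def
    proof
      show "inj_on (\<lambda>x. extend_alloc (fst x) b (snd x)) (Sigma {..<b} feasible_allocations)"
        using extend_alloc_inj by (force simp: inj_on_def)
      show "(\<lambda>x. extend_alloc (fst x) b (snd x)) ` Sigma {..<b} feasible_allocations = feasible_allocations b"
        using feasible_decompose[OF _ assms] by (force intro: extend_alloc_feasible)
    qed
    from sum.reindex_bij_betw[OF this, of f] show ?thesis
      by (simp add: case_prod_unfold)
  qed
  finally show ?thesis by simp
qed

section \<open>Recursion for the signed weights and for the sum over allocations\<close>

text \<open>The node list \<open>[..., a, a]\<close> becomes \<open>[..., a, b, b]\<close>. The
  repeated last node gives an empty product in both, so the only new factor is the one from
  \<open>a\<close> to \<open>b\<close>, and the additional mark raises the exponent of -1 by one.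
  The shorter list ends in \<open>a, a\<close> because its largest index \<open>a\<close> is
  marked.\<close>

lemma b_marked_extend:
  assumes J: "J \<subseteq> {1..a}" "a \<in> J" and ab: "a < b"
  shows "b_marked l {1..b} (insert b J) = - b_marked l {1..a} J * rate_weight l a b"
proof -
  have fin: "finite J" using J by (rule_tac finite_subset) auto
  have a: "a \<ge> 1" using J by auto
  have bJ: "b \<notin> J" using J ab by auto
  define xs where "xs = sorted_list_of_set (J - {a})"
  have len: "length xs = card J - 1" and cJ: "card J \<ge> 1"
    using fin J by (auto simp: xs_def card_Diff_singleton card_gt_0_iff Suc_le_eq)
  have xs: "set xs = J - {a}" "sorted_wrt (<) xs"
    using fin by (auto simp: xs_def)
  have le: "x < a" if "x \<in> J - {a}" for x
    using J that by (auto simp: less_le)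
  have lb: "x < b" if "x \<in> J - {a}" for x
    using le[OF that] ab by simp
  have sJ: "sorted_list_of_set J = xs @ [a]"
    by (rule sorted_list_of_set_unique[OF fin, THEN iffD1])
      (use xs len cJ J le in \<open>auto simp: sorted_wrt_append\<close>)
  have sJ': "sorted_list_of_set (insert b J) = xs @ [a, b]"
    by (rule sorted_list_of_set_unique[THEN iffD1])
      (use xs len cJ J fin ab bJ le lb in \<open>auto simp: sorted_wrt_append\<close>)
  have Mx: "Min {1..a} = 1" "Max {1..a} = a" "Min {1..b} = 1" "Max {1..b} = b"
    using a ab by (auto intro!: Min_eqI Max_eqI)
  define n where "n = length xs"
  have cJ2: "card J = Suc n" using len cJ by (simp add: n_def)
  have n1: "b_nodes {1..a} J = 1 # xs @ [a, a]" and n2: "b_nodes {1..b} (insert b J) = 1 # xs @ [a, b, b]"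
    using sJ sJ' Mx by (simp_all add: b_nodes_def)
  define F where "F zs m = (\<Prod>k=zs ! m ..< zs ! (m + 1). l k / (l k - l (zs ! (m + 1))))" for zs :: "nat list" and m
  have "(\<Prod>m=0..card J. F (b_nodes {1..a} J) m) = (\<Prod>m=0..n. F (1 # xs @ [a, a]) m)"
    unfolding n1 cJ2 prod.atLeast0_atMost_Suc by (simp add: F_def n_def nth_append)
  also have "\<dots> = (\<Prod>m=0..n. F (1 # xs @ [a, b, b]) m)"
    by (rule prod.cong) (auto simp: F_def n_def nth_append nth_Cons split: nat.splits)
  finally have A: "(\<Prod>m=0..card J. F (b_nodes {1..a} J) m) = (\<Prod>m=0..n. F (1 # xs @ [a, b, b]) m)" .
  have B: "(\<Prod>m=0..card (insert b J). F (b_nodes {1..b} (insert b J)) m) =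
      (\<Prod>m=0..n. F (1 # xs @ [a, b, b]) m) * rate_weight l a b"
    unfolding n2 using fin bJ cJ2
    by (simp add: prod.atLeast0_atMost_Suc) (simp add: F_def n_def nth_append rate_weight_def)
  show ?thesis
    unfolding b_marked_def F_def[symmetric] A B using fin bJ cJ2
    by (simp add: power_int_def nat_add_distrib)
qed

lemma b_marked_single:
  assumes "b \<ge> 1"
  shows "b_marked l {1..b} {b} = rate_weight l 1 b"
proof -
  have Mx: "Min {1..b} = 1" "Max {1..b} = b"
    using assms by (auto intro!: Min_eqI Max_eqI)
  show ?thesis using Mx
    by (simp add: b_marked_def b_nodes_def rate_weight_def atLeast0_atMost_Suc)
qed

lemma support_extend:
  assumes "a < b"
  shows "{j \<in> {1..b}. extend_alloc a b u j \<noteq> 0} = insert b {j \<in> {1..a}. u j \<noteq> 0}"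
  using assms by (auto simp: extend_alloc_def)

text \<open>For \<open>a = 0\<close> the node before \<open>b\<close> is \<open>k(0) = 1\<close>,
  not 0, and there is no earlier mark that would bring a sign; hence the separate case.\<close>

lemma b_powers_extend:
  assumes u: "u \<in> feasible_allocations a" and ab: "a < b"
  shows "b_powers l b (extend_alloc a b u) =
    (if a = 0 then rate_weight l 1 b else - b_powers l a u * rate_weight l a b)"
proof (cases "a = 0")
  case True
  then show ?thesis unfolding b_powers_def support_extend[OF ab] using ab b_marked_single[of b l] by simp
next
  case False
  then have "u a \<noteq> 0" using u by (simp add: feasible_alt)
  then show ?thesis unfolding b_powers_def support_extend[OF ab]
    using False ab by (subst b_marked_extend[of _ a]) auto
qed

lemma prod_extend:
  fixes r :: "nat \<Rightarrow> real"
  assumes "a < b"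
  shows "(\<Prod>j=1..b. r j ^ extend_alloc a b u j) = (\<Prod>j=1..a. r j ^ u j) * r b ^ (b - a)"
proof -
  have s: "{1..b} = {1..a} \<union> {a<..<b} \<union> {b}" using assms by auto
  have "(\<Prod>j=1..b. r j ^ extend_alloc a b u j) =
      (\<Prod>j\<in>{1..a}. r j ^ extend_alloc a b u j) * (\<Prod>j\<in>{a<..<b}. r j ^ extend_alloc a b u j) * r b ^ extend_alloc a b u b"
    unfolding s using assms by (subst prod.union_disjoint, simp, simp, force)+ simp
  also have "(\<Prod>j\<in>{1..a}. r j ^ extend_alloc a b u j) = (\<Prod>j=1..a. r j ^ u j)"
    using assms by (intro prod.cong) (auto simp: extend_alloc_def)
  also have "(\<Prod>j\<in>{a<..<b}. r j ^ extend_alloc a b u j) = 1"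
    using assms by (intro prod.neutral) (auto simp: extend_alloc_def)
  finally show ?thesis using assms by (simp add: extend_alloc_def)
qed

definition alloc_sum :: "(nat \<Rightarrow> real) \<Rightarrow> (nat \<Rightarrow> real) \<Rightarrow> nat \<Rightarrow> real" where
  "alloc_sum l r n = (\<Sum>u\<in>feasible_allocations n. b_powers l n u * (\<Prod>j=1..n. r j ^ u j))"

text \<open>With the subtracted sum moved to the left, this is \<open>hit_weight_identity\<close>
  with \<open>alloc_sum\<close> in place of the hitting probabilities.\<close>

lemma alloc_sum_rec:
  assumes "b \<ge> 1"
  shows "alloc_sum l r b =
    rate_weight l 1 b * r b ^ b - (\<Sum>a=1..<b. alloc_sum l r a * rate_weight l a b * r b ^ (b - a))"
proof -
  let ?t = "\<lambda>a u. b_powers l b (extend_alloc a b u) * (\<Prod>j=1..b. r j ^ extend_alloc a b u j)"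
  have "alloc_sum l r b = (\<Sum>a<b. \<Sum>u\<in>feasible_allocations a. ?t a u)"
    unfolding alloc_sum_def by (rule sum_feasible[OF assms])
  also have "\<dots> = (\<Sum>u\<in>feasible_allocations 0. ?t 0 u) + (\<Sum>a=1..<b. \<Sum>u\<in>feasible_allocations a. ?t a u)"
    using assms by (simp add: lessThan_atLeast0 sum.atLeast_Suc_lessThan)
  also have "(\<Sum>u\<in>feasible_allocations 0. ?t 0 u) = rate_weight l 1 b * r b ^ b"
    using assms prod_extend[of 0 b r "\<lambda>_. undefined"] b_powers_extend[of "\<lambda>_. undefined" 0 b l]
    by (simp add: feasible_0)
  also have "(\<Sum>a=1..<b. \<Sum>u\<in>feasible_allocations a. ?t a u) =
      (\<Sum>a=1..<b. - (alloc_sum l r a * rate_weight l a b * r b ^ (b - a)))"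
  proof (rule sum.cong)
    fix a assume a: "a \<in> {1..<b}"
    show "(\<Sum>u\<in>feasible_allocations a. ?t a u) = - (alloc_sum l r a * rate_weight l a b * r b ^ (b - a))"
      unfolding alloc_sum_def sum_distrib_right sum_negf[symmetric]
      using a by (intro sum.cong) (auto simp: b_powers_extend prod_extend simp del: One_nat_def)
  qed simp
  finally show ?thesis by (simp add: sum_negf)
qed

text \<open>The unknown with index \<open>b\<close> has the coefficient
  \<open>rate_weight l b b = 1\<close> in its equation, so the earlier ones determine it.\<close>

lemma hit_eq_alloc_sum:
  assumes "lam > 0" "mu > 0" "1 \<le> i" "i \<le> N"
  shows "hit N (rho N lam mu) (\<lambda>l. of_bool (l = i)) 0 1 = alloc_sum (arr_rate N lam) (rho N lam mu) i"
  using assms(3,4)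
proof (induction i rule: less_induct)
  case (less b)
  let ?q = "\<lambda>i. hit N (rho N lam mu) (\<lambda>l. of_bool (l = i)) 0 1"
  let ?w = "\<lambda>i. rate_weight (arr_rate N lam) i b * rho N lam mu b ^ (b - i)"
  have "rate_weight (arr_rate N lam) 1 b * rho N lam mu b ^ b = (\<Sum>i=1..b. ?q i * ?w i)"
    using hit_weight_identity[OF assms(1,2) less.prems] by (simp add: mult.assoc)
  also have "{1..b} = insert b {1..<b}" using less.prems by auto
  also have "(\<Sum>i\<in>insert b {1..<b}. ?q i * ?w i) = ?q b + (\<Sum>i=1..<b. ?q i * ?w i)"
    by simp
  also have "(\<Sum>i=1..<b. ?q i * ?w i) = (\<Sum>i=1..<b. alloc_sum (arr_rate N lam) (rho N lam mu) i * ?w i)"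
    using less by (intro sum.cong) auto
  finally show ?case
    using less.prems by (simp add: alloc_sum_rec mult.assoc)
qed

subsection \<open>The embedded chain\<close>

text \<open>The chain keeps moving after its first return; this predicate tells when the stopped
  value is frozen.\<close>

definition returned :: "(nat \<times> nat) list \<Rightarrow> bool" where
  "returned xs \<longleftrightarrow> (\<exists>k. 0 < k \<and> k < length xs \<and> fst (xs ! k) = snd (xs ! k))"

lemma returned_snoc:
  assumes "xs \<noteq> []"
  shows "returned (xs @ [x]) \<longleftrightarrow> returned xs \<or> fst x = snd x"
proof -
  have "returned (xs @ [x]) \<longleftrightarrow>
      (\<exists>k. (0 < k \<and> k < length xs \<and> fst (xs ! k) = snd (xs ! k)) \<or> (k = length xs \<and> fst x = snd x))"
    unfolding returned_def using assms by (intro iff_exI) (auto simp: nth_append)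
  then show ?thesis by (auto simp: returned_def)
qed

lemma first_return_at_snoc_returned:
  assumes "returned xs"
  shows "first_return_at i (xs @ [x]) \<longleftrightarrow> first_return_at i xs"
proof
  assume "first_return_at i (xs @ [x])"
  then obtain k where k: "0 < k" "k < length xs + 1" "(xs @ [x]) ! k = (i, i)"
    "\<And>l. 0 < l \<Longrightarrow> l < k \<Longrightarrow> fst ((xs @ [x]) ! l) \<noteq> snd ((xs @ [x]) ! l)"
    unfolding first_return_at_def by auto
  have "k < length xs"
  proof (rule ccontr)
    assume "\<not> k < length xs"
    then have "k = length xs" using k by simp
    with k(4) assms show False unfolding returned_def by (auto simp: nth_append)
  qed
  with k show "first_return_at i xs"
    unfolding first_return_at_def by (auto simp: nth_append intro!: exI[of _ k])
next
  assume "first_return_at i xs"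
  then obtain k where "0 < k" "k < length xs" "xs ! k = (i, i)"
    "\<And>l. 0 < l \<Longrightarrow> l < k \<Longrightarrow> fst (xs ! l) \<noteq> snd (xs ! l)"
    unfolding first_return_at_def by auto
  then show "first_return_at i (xs @ [x])"
    unfolding first_return_at_def by (auto simp: nth_append intro!: exI[of _ k])
qed

lemma first_return_at_snoc_fresh:
  assumes "\<not> returned xs" "xs \<noteq> []" "fst x = snd x"
  shows "first_return_at i (xs @ [x]) \<longleftrightarrow> x = (i, i)"
proof
  assume "first_return_at i (xs @ [x])"
  then obtain k where k: "0 < k" "k < length xs + 1" "(xs @ [x]) ! k = (i, i)"
    unfolding first_return_at_def by auto
  with assms(1) have "\<not> k < length xs" unfolding returned_def by (auto simp: nth_append)
  then have "k = length xs" using k by simp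
  with k show "x = (i, i)" by simp
next
  assume "x = (i, i)"
  with assms show "first_return_at i (xs @ [x])"
    unfolding first_return_at_def returned_def
    by (auto simp: nth_append intro!: exI[of _ "length xs"])
qed

text \<open>Strictly above the diagonal every step adds one to the coordinate sum. As
  \<open>fst < snd \<le> N\<close> keeps that sum below \<open>2 * N\<close>, every path of
  \<open>2 * N\<close> steps has returned, which is what this lemma is for.\<close>

lemma chain_path_support:
  assumes "xs \<in> set_pmf (chain_path N lam mu n)" and lam: "lam > 0" and mu: "mu > 0" and N: "N \<ge> 1"
  shows "length xs = Suc n"
    and "n \<ge> 1 \<Longrightarrow> \<not> returned xs \<Longrightarrow>
           fst (last xs) < snd (last xs) \<and> snd (last xs) \<le> N \<and> fst (last xs) + snd (last xs) = n"
proof -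
  have "length xs = Suc n \<and> (n = 0 \<longrightarrow> xs = [(0, 0)]) \<and> (n \<ge> 1 \<longrightarrow> \<not> returned xs \<longrightarrow>
      fst (last xs) < snd (last xs) \<and> snd (last xs) \<le> N \<and> fst (last xs) + snd (last xs) = n)"
    using assms(1)
  proof (induction n arbitrary: xs)
    case (Suc n)
    from Suc.prems obtain ys x where ys: "ys \<in> set_pmf (chain_path N lam mu n)"
      and x: "x \<in> set_pmf (chain_step N lam mu (last ys))" and xs: "xs = ys @ [x]"
      by auto
    note IH = Suc.IH[OF ys]
    obtain a b where ab: "last ys = (a, b)" by fastforce
    have ne: "ys \<noteq> []" using IH by auto
    show ?case
    proof (cases "n = 0")
      case True
      with IH ab x xs N show ?thesis by auto
    next
      case False
      have "fst x < snd x \<and> snd x \<le> N \<and> fst x + snd x = Suc n" if nr: "\<not> returned xs"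
      proof -
        have nr': "\<not> returned ys" "fst x \<noteq> snd x" using nr ne by (auto simp: xs returned_snoc)
        then have ab': "a < b" "b \<le> N" "a + b = n" using IH False ab by auto
        have "x = (Suc a, b) \<or> x = (a, Suc b) \<and> b < N"
        \<comment> \<open>At height \<open>N\<close> a service has probability 1, so the branch that
          would leave the lattice is outside the support.\<close>
        proof (cases "b = N")
          case True
          then show ?thesis
            using x ab ab' mu by (auto simp: rho_def arr_rate_def bernoulli_pmf.rep_eq set_pmf_iff split: if_splits)
        next
          case False
          then show ?thesis using x ab ab' by (auto split: if_splits)
        qed
        then show ?thesis using ab' nr' by auto
      qed
      then show ?thesis using IH xs by simp
    qed
  qed simp
  then show "length xs = Suc n" "n \<ge> 1 \<Longrightarrow> \<not> returned xs \<Longrightarrow>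
      fst (last xs) < snd (last xs) \<and> snd (last xs) \<le> N \<and> fst (last xs) + snd (last xs) = n"
    by auto
qed

lemma finite_chain_step: "finite (set_pmf (chain_step N lam mu x))"
  by (cases x) (auto intro: finite_subset[OF subset_UNIV])

lemma finite_chain_path: "finite (set_pmf (chain_path N lam mu n))"
  by (induction n) (auto simp: finite_chain_step simp del: chain_step.simps)

text \<open>The value of \<open>hit\<close> at the current state, stopped at the first return, is a martingale.\<close>
lemma prob_first_return:
  assumes N: "N \<ge> 1" and lam: "lam > 0" and mu: "mu > 0"
  shows "measure_pmf.prob (chain_path N lam mu (2 * N)) {xs. first_return_at i xs} =
    hit N (rho N lam mu) (\<lambda>l. of_bool (l = i)) 0 1"
proof -
  define q where "q = hit N (rho N lam mu) (\<lambda>l. of_bool (l = i))"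
  define val where "val xs = (if returned xs then of_bool (first_return_at i xs) else q (fst (last xs)) (snd (last xs)))" for xs
  have val_step: "measure_pmf.expectation (chain_step N lam mu (last xs)) (\<lambda>x. val (xs @ [x])) = val xs"
    if xs: "xs \<in> set_pmf (chain_path N lam mu n)" and n: "n \<ge> 1" for xs n
  proof (cases "returned xs")
    case True
    then have "xs \<noteq> []" by (auto simp: returned_def)
    with True show ?thesis by (simp add: val_def returned_snoc first_return_at_snoc_returned)
  next
    case False
    have ne: "xs \<noteq> []" using chain_path_support(1)[OF xs lam mu N] by auto
    obtain a b where ab: "last xs = (a, b)" by fastforce
    then have "a < b" "b \<le> N" using chain_path_support(2)[OF xs lam mu N n False] by auto
    \<comment> \<open>On reaching the diagonal the boundary value of \<open>q\<close> is the
      indicator of a first return at \<open>(i, i)\<close>, so one formula covers both branches of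
      \<open>val\<close>.\<close>
    have v: "val (xs @ [x]) = q (fst x) (snd x)" for x
    proof (cases "fst x = snd x")
      case True
      then show ?thesis using False ne
        by (cases x) (auto simp: val_def returned_snoc first_return_at_snoc_fresh q_def)
    next
      case False
      then show ?thesis using \<open>\<not> returned xs\<close> ne by (simp add: val_def returned_snoc)
    qed
    have r: "0 \<le> rho N lam mu b" "rho N lam mu b \<le> 1"
      using rho_bounds[OF lam mu \<open>b \<le> N\<close>] by auto
    have "measure_pmf.expectation (chain_step N lam mu (last xs)) (\<lambda>x. val (xs @ [x])) =
        q (Suc a) b * rho N lam mu b + q a (Suc b) * (1 - rho N lam mu b)"
      using ab \<open>a < b\<close> r by (simp add: v)
    also have "\<dots> = q a b"
    proof (cases "b = N")
      case True
      then show ?thesis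
        using \<open>a < b\<close> rho_full[OF lam mu, of N] hit_step_full[of a N "rho N lam mu"] by (simp add: q_def)
    next
      case False
      then have "b < N" using \<open>b \<le> N\<close> by simp
      then show ?thesis using hit_step[OF \<open>a < b\<close>] by (simp add: q_def mult.commute)
    qed
    finally show ?thesis using False ab by (simp add: val_def)
  qed
  \<comment> \<open>The martingale starts at time 1: at time 0 the state is \<open>(0, 0)\<close>,
    where \<open>q\<close> is a boundary value and not the expectation sought.\<close>
  have mart: "measure_pmf.expectation (chain_path N lam mu (Suc n)) val = q 0 1" for n
  proof (induction n)
    case 0
    have "\<not> returned [(0, 0), (0, 1)]" by (auto simp: returned_def less_Suc_eq)
    then show ?case using N by (simp add: bind_return_pmf val_def)
  next
    case (Suc n)
    let ?p = "chain_path N lam mu (Suc n)"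
    have "measure_pmf.expectation (chain_path N lam mu (Suc (Suc n))) val =
        (\<Sum>xs\<in>set_pmf ?p. pmf ?p xs *\<^sub>R measure_pmf.expectation (map_pmf (\<lambda>x. xs @ [x]) (chain_step N lam mu (last xs))) val)"
      unfolding chain_path.simps(2)[of N lam mu "Suc n"]
      by (rule pmf_expectation_bind) (auto simp: finite_chain_step finite_chain_path simp del: chain_step.simps chain_path.simps)
    also have "\<dots> = (\<Sum>xs\<in>set_pmf ?p. val xs * pmf ?p xs)"
      by (rule sum.cong) (simp_all add: val_step[of _ "Suc n"] mult.commute del: chain_step.simps chain_path.simps)
    also have "\<dots> = measure_pmf.expectation ?p val"
      by (rule integral_measure_pmf_real[symmetric]) (auto simp: finite_chain_path simp del: chain_path.simps)
    finally show ?case using Suc by simp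
  qed
  let ?p = "chain_path N lam mu (2 * N)"
  have ret: "returned xs" if "xs \<in> set_pmf ?p" for xs
    using chain_path_support(2)[OF that lam mu N] N by linarith
  have "measure_pmf.prob ?p {xs. first_return_at i xs} = measure_pmf.expectation ?p (indicator {xs. first_return_at i xs})"
    by simp
  also have "\<dots> = measure_pmf.expectation ?p val"
    by (rule integral_cong_AE) (auto simp: AE_measure_pmf_iff val_def ret indicator_def)
  also have "\<dots> = q 0 1" using mart[of "2 * N - 1"] N by (simp del: chain_path.simps)
  finally show ?thesis by (simp add: q_def)
qed

subsection \<open>Exponential clocks\<close>

definition expo :: "real \<Rightarrow> real measure" where
  "expo r = density lborel (exponential_density r)"

lemma sets_expo [simp, measurable_cong]: "sets (expo r) = sets borel"
  by (simp add: expo_def)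

lemma space_expo [simp]: "space (expo r) = UNIV"
  by (simp add: expo_def)

lemma prob_space_expo: "r > 0 \<Longrightarrow> prob_space (expo r)"
  unfolding expo_def by (rule prob_space_exponential_density)

lemma AE_expo_pos: "r > 0 \<Longrightarrow> AE x in expo r. x > 0"
proof -
  have "AE x::real in lborel. x \<noteq> 0" by (rule AE_lborel_singleton)
  then have "AE x in lborel. 0 < ennreal (exponential_density r x) \<longrightarrow> x > 0"
    by eventually_elim (auto simp: exponential_density_def split: if_splits)
  then show ?thesis unfolding expo_def by (subst AE_density) auto
qed

lemma AE_expo_neq: "AE x in expo r. x \<noteq> c"
proof -
  have "AE x::real in lborel. x \<noteq> c" by (rule AE_lborel_singleton)
  then have "AE x in lborel. 0 < ennreal (exponential_density r x) \<longrightarrow> x \<noteq> c"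
    by eventually_elim auto
  then show ?thesis unfolding expo_def by (subst AE_density) auto
qed

lemma nn_integral_expo:
  assumes "f \<in> borel_measurable borel"
  shows "(\<integral>\<^sup>+x. f x \<partial>expo r) = (\<integral>\<^sup>+x. ennreal (exponential_density r x) * f x \<partial>lborel)"
  using assms unfolding expo_def by (subst nn_integral_density) auto

text \<open>Memorylessness for an arbitrary nonnegative integrand, in which form it can be applied
  to one coordinate of a product; translation by \<open>s\<close> multiplies the density by
  \<open>exp (- r * s)\<close>.\<close>

lemma nn_integral_expo_beyond:
  assumes [measurable]: "f \<in> borel_measurable borel" and r: "r > 0" and s: "s \<ge> 0"
  shows "(\<integral>\<^sup>+x. f x * indicator {s<..} x \<partial>expo r) =
         ennreal (exp (- r * s)) * (\<integral>\<^sup>+x. f (x + s) \<partial>expo r)"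
proof -
  have "(\<integral>\<^sup>+x. f x * indicator {s<..} x \<partial>expo r) =
        (\<integral>\<^sup>+x. ennreal (exponential_density r x) * (f x * indicator {s<..} x) \<partial>lborel)"
    by (rule nn_integral_expo) measurable
  also have "\<dots> = (\<integral>\<^sup>+x. ennreal (exponential_density r (s + x)) * (f (s + x) * indicator {s<..} (s + x)) \<partial>lborel)"
    by (subst nn_integral_real_affine[where c = 1 and t = s]) simp_all
  also have "\<dots> = (\<integral>\<^sup>+x. ennreal (exp (- r * s)) * (ennreal (exponential_density r x) * f (x + s)) \<partial>lborel)"
  proof (rule nn_integral_cong_AE)
    show "AE x in lborel. ennreal (exponential_density r (s + x)) * (f (s + x) * indicator {s<..} (s + x)) =
        ennreal (exp (- r * s)) * (ennreal (exponential_density r x) * f (x + s))"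
      \<comment> \<open>At \<open>x = 0\<close> the indicator vanishes while the density does not,
        so this point is excluded as a null set.\<close>
      using AE_lborel_singleton[of "0::real"]
    proof eventually_elim
      fix x :: real assume "x \<noteq> 0"
      then consider "x < 0" | "x > 0" by linarith
      then show "ennreal (exponential_density r (s + x)) * (f (s + x) * indicator {s<..} (s + x)) =
        ennreal (exp (- r * s)) * (ennreal (exponential_density r x) * f (x + s))"
      proof cases
        case 1
        then show ?thesis by (simp add: exponential_density_def)
      next
        case 2
        have "exp (- r * s) * exponential_density r x = exponential_density r (s + x)"
          using 2 s by (simp add: exponential_density_def exp_add[symmetric] algebra_simps)
        then have "ennreal (exp (- r * s)) * ennreal (exponential_density r x) = ennreal (exponential_density r (s + x))"
          using r by (subst ennreal_mult[symmetric]) (auto simp: exponential_density_nonneg)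
        then show ?thesis using 2 by (simp add: mult.assoc[symmetric] add.commute)
      qed
    qed
  qed
  also have "\<dots> = ennreal (exp (- r * s)) * (\<integral>\<^sup>+x. f (x + s) \<partial>expo r)"
    by (subst nn_integral_cmult, measurable) (subst nn_integral_expo, auto)
  finally show ?thesis .
qed

section \<open>Finite families of independent exponential clocks\<close>

locale exponential_clocks =
  fixes r :: "'i \<Rightarrow> real"
  assumes rate_pos: "\<And>k. r k > 0"
begin

abbreviation clocks :: "'i set \<Rightarrow> ('i \<Rightarrow> real) measure" where
  "clocks K \<equiv> PiM K (\<lambda>k. expo (r k))"

sublocale product_sigma_finite "\<lambda>k. expo (r k)"
  unfolding product_sigma_finite_def
  using prob_space_expo[OF rate_pos] by (auto intro: prob_space_imp_sigma_finite)

text \<open>Both orders are needed: with clock \<open>a\<close> inside, a single clock can be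
  shifted; with \<open>a\<close> outside, one conditions on the time at which it rings.\<close>

lemma nn_integral_clocks_split:
  assumes "finite K" "a \<in> K" "f \<in> borel_measurable (clocks K)"
  shows "(\<integral>\<^sup>+x. f x \<partial>clocks K) = (\<integral>\<^sup>+x. \<integral>\<^sup>+y. f (x(a := y)) \<partial>expo (r a) \<partial>clocks (K - {a}))"
    and "(\<integral>\<^sup>+x. f x \<partial>clocks K) = (\<integral>\<^sup>+y. \<integral>\<^sup>+x. f (x(a := y)) \<partial>clocks (K - {a}) \<partial>expo (r a))"
  using product_nn_integral_insert[of "K - {a}" a f] product_nn_integral_insert_rev[of "K - {a}" a f]
    insert_Diff[of a K] assms by simp_all

lemma AE_clocks_pos:
  assumes "finite K"
  shows "AE x in clocks K. \<forall>j\<in>K. x j > 0"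
  using assms by (intro AE_finite_allI AE_PiM_component AE_expo_pos rate_pos prob_space_expo) auto

text \<open>With all other clocks fixed, a tie confines \<open>x a\<close> to one point, which an
  exponential law does not charge.\<close>

lemma AE_clocks_distinct:
  assumes K: "finite K" "a \<in> K" "b \<in> K" "a \<noteq> b"
  shows "AE x in clocks K. x a \<noteq> x b"
proof -
  have [measurable]: "(\<lambda>x. x a) \<in> borel_measurable (clocks K)" "(\<lambda>x. x b) \<in> borel_measurable (clocks K)"
    using K measurable_component_singleton[of a K "\<lambda>k. expo (r k)"]
      measurable_component_singleton[of b K "\<lambda>k. expo (r k)"] by (auto cong: measurable_cong_sets)
  define S where "S = {x \<in> space (clocks K). x a = x b}"
  have S: "S \<in> sets (clocks K)" unfolding S_def by measurable
  have "emeasure (clocks K) S = (\<integral>\<^sup>+x. indicator S x \<partial>clocks K)"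
    using S by simp
  also have "\<dots> = (\<integral>\<^sup>+x. \<integral>\<^sup>+y. indicator S (x(a := y)) \<partial>expo (r a) \<partial>clocks (K - {a}))"
    using K S by (intro nn_integral_clocks_split) auto
  also have "\<dots> = (\<integral>\<^sup>+x. 0 \<partial>clocks (K - {a}))"
  proof (rule nn_integral_cong)
    fix x
    have "AE y in expo (r a). indicator S (x(a := y)) = (0 :: ennreal)"
      using AE_expo_neq[where r = "r a" and c = "x b"] by eventually_elim (use K in \<open>auto simp: S_def indicator_def\<close>)
    then have "(\<integral>\<^sup>+y. indicator S (x(a := y)) \<partial>expo (r a)) = (\<integral>\<^sup>+y. 0 \<partial>expo (r a))"
      by (rule nn_integral_cong_AE)
    then show "(\<integral>\<^sup>+y. indicator S (x(a := y)) \<partial>expo (r a)) = 0" by simp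
  qed
  finally have "emeasure (clocks K) S = 0" by simp
  with S have "S \<in> null_sets (clocks K)" by auto
  then show ?thesis by (rule AE_I') (auto simp: S_def)
qed

lemma measurable_shift [measurable]:
  assumes "J \<subseteq> K"
  shows "(\<lambda>x. \<lambda>j\<in>K. if j \<in> J then x j + s else x j) \<in> measurable (clocks K) (clocks K)"
proof (rule measurable_restrict)
  fix j assume "j \<in> K"
  then have "(\<lambda>x. x j) \<in> borel_measurable (clocks K)"
    using measurable_component_singleton[of j K "\<lambda>k. expo (r k)"] by (auto cong: measurable_cong_sets)
  then show "(\<lambda>x. if j \<in> J then x j + s else x j) \<in> measurable (clocks K) (expo (r j))"
    by (auto cong: measurable_cong_sets)
qed

text \<open>Independence allows the clocks of \<open>J\<close> to be shifted one at a time, and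
  their rates add up in the exponent. The integrand is arbitrary because the induction absorbs the
  condition on the next clock into it.\<close>

lemma nn_integral_clocks_beyond:
  assumes K: "finite K" and J: "J \<subseteq> K" and s: "s \<ge> 0"
    and f: "f \<in> borel_measurable (clocks K)"
  shows "(\<integral>\<^sup>+x. f x * indicator {x. \<forall>j\<in>J. x j > s} x \<partial>clocks K) =
    ennreal (exp (- (\<Sum>j\<in>J. r j) * s)) * (\<integral>\<^sup>+x. f (\<lambda>j\<in>K. if j \<in> J then x j + s else x j) \<partial>clocks K)"
  using finite_subset[OF J K] J f
proof (induction J arbitrary: f)
  case empty
  have "(\<integral>\<^sup>+x. f x \<partial>clocks K) = (\<integral>\<^sup>+x. f (\<lambda>j\<in>K. x j) \<partial>clocks K)"
    by (rule nn_integral_cong) (auto simp: space_PiM PiE_restrict)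
  then show ?case by (simp add: restrict_def)
next
  case (insert a J)
  note [measurable] = insert.prems(2)
  have comp [measurable]: "(\<lambda>x. x j) \<in> borel_measurable (clocks K)" if "j \<in> K" for j
    using that measurable_component_singleton[of j K "\<lambda>k. expo (r k)"] by (auto cong: measurable_cong_sets)
  have aK: "a \<in> K" using insert.prems by auto
  note [measurable] = comp[OF aK]
  define g where "g x = f x * indicator {x. x a > s} x" for x
  have [measurable]: "g \<in> borel_measurable (clocks K)"
    unfolding g_def indicator_def by measurable
  let ?sh = "\<lambda>J x. \<lambda>j\<in>K. if j \<in> J then x j + s else x j"
  have "(\<integral>\<^sup>+x. f x * indicator {x. \<forall>j\<in>insert a J. x j > s} x \<partial>clocks K) =
        (\<integral>\<^sup>+x. g x * indicator {x. \<forall>j\<in>J. x j > s} x \<partial>clocks K)"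
    by (rule nn_integral_cong) (auto simp: g_def indicator_def)
  also have "\<dots> = ennreal (exp (- (\<Sum>j\<in>J. r j) * s)) * (\<integral>\<^sup>+x. g (?sh J x) \<partial>clocks K)"
    using insert.prems by (intro insert.IH) auto
  also have "(\<integral>\<^sup>+x. g (?sh J x) \<partial>clocks K) = (\<integral>\<^sup>+x. \<integral>\<^sup>+y. g (?sh J (x(a := y))) \<partial>expo (r a) \<partial>clocks (K - {a}))"
    using insert.prems aK K by (intro nn_integral_clocks_split measurable_compose[OF measurable_shift]) auto
  also have "\<dots> = (\<integral>\<^sup>+x. \<integral>\<^sup>+y. f ((?sh J x)(a := y)) * indicator {s<..} y \<partial>expo (r a) \<partial>clocks (K - {a}))"
  proof (intro nn_integral_cong)
    fix x y
    have "?sh J (x(a := y)) = (?sh J x)(a := y)" using aK insert.hyps by auto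
    then show "g (?sh J (x(a := y))) = f ((?sh J x)(a := y)) * indicator {s<..} y"
      by (simp add: g_def indicator_def)
  qed
  also have "\<dots> = (\<integral>\<^sup>+x. ennreal (exp (- r a * s)) * (\<integral>\<^sup>+y. f ((?sh J x)(a := y + s)) \<partial>expo (r a)) \<partial>clocks (K - {a}))"
  proof (rule nn_integral_cong)
    fix x assume x: "x \<in> space (clocks (K - {a}))"
    have "(\<lambda>y. (?sh J x)(a := y)) \<in> measurable borel (clocks K)"
    proof (rule measurable_PiM_single')
      fix i assume "i \<in> K"
      show "(\<lambda>y. ((?sh J x)(a := y)) i) \<in> measurable borel (expo (r i))"
        by (cases "i = a") (auto cong: measurable_cong_sets)
    qed (use aK in auto)
    then have "(\<lambda>y. f ((?sh J x)(a := y))) \<in> borel_measurable borel"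
      by (rule measurable_compose) fact
    from nn_integral_expo_beyond[OF this rate_pos s]
    show "(\<integral>\<^sup>+y. f ((?sh J x)(a := y)) * indicator {s<..} y \<partial>expo (r a)) =
        ennreal (exp (- r a * s)) * (\<integral>\<^sup>+y. f ((?sh J x)(a := y + s)) \<partial>expo (r a))" .
  qed
  also have "\<dots> = (\<integral>\<^sup>+x. \<integral>\<^sup>+y. ennreal (exp (- r a * s)) * f (?sh (insert a J) (x(a := y))) \<partial>expo (r a) \<partial>clocks (K - {a}))"
  proof (rule nn_integral_cong)
    fix x assume x: "x \<in> space (clocks (K - {a}))"
    have eq: "?sh (insert a J) (x(a := y)) = (?sh J x)(a := y + s)" for y using aK insert.hyps by auto
    have "(\<lambda>y. (?sh J x)(a := y + s)) \<in> measurable borel (clocks K)"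
    proof (rule measurable_PiM_single')
      fix i assume "i \<in> K"
      show "(\<lambda>y. ((?sh J x)(a := y + s)) i) \<in> measurable borel (expo (r i))"
        by (cases "i = a") (auto cong: measurable_cong_sets)
    qed (use aK in auto)
    then have [measurable]: "(\<lambda>y. f ((?sh J x)(a := y + s))) \<in> borel_measurable (expo (r a))"
      by (auto intro: measurable_compose[OF _ insert.prems(2)] cong: measurable_cong_sets)
    show "ennreal (exp (- r a * s)) * (\<integral>\<^sup>+y. f ((?sh J x)(a := y + s)) \<partial>expo (r a)) =
      (\<integral>\<^sup>+y. ennreal (exp (- r a * s)) * f (?sh (insert a J) (x(a := y))) \<partial>expo (r a))"
      unfolding eq by (subst nn_integral_cmult) auto
  qed
  also have "\<dots> = (\<integral>\<^sup>+x. ennreal (exp (- r a * s)) * f (?sh (insert a J) x) \<partial>clocks K)"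
    using insert.prems aK K
    by (intro nn_integral_clocks_split(1)[symmetric] borel_measurable_times measurable_compose[OF measurable_shift]) auto
  also have "\<dots> = ennreal (exp (- r a * s)) * (\<integral>\<^sup>+x. f (?sh (insert a J) x) \<partial>clocks K)"
    using insert.prems by (intro nn_integral_cmult measurable_compose[OF measurable_shift]) auto
  also have "ennreal (exp (- (\<Sum>j\<in>J. r j) * s)) * (ennreal (exp (- r a * s)) * (\<integral>\<^sup>+x. f (?sh (insert a J) x) \<partial>clocks K)) =
     ennreal (exp (- (\<Sum>j\<in>insert a J. r j) * s)) * (\<integral>\<^sup>+x. f (?sh (insert a J) x) \<partial>clocks K)"
    using insert.hyps
    by (simp add: mult.assoc[symmetric] ennreal_mult[symmetric] exp_add[symmetric] algebra_simps)
  finally show ?case .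
qed

text \<open>The clocks in \<open>I\<close> run concurrently, the others have not been started. If \<open>m\<close> rings first, the
  remaining clocks of \<open>I\<close> restart by memorylessness. The events \<open>E' m\<close> describe the situation
  from then on.\<close>
lemma race:
  assumes K: "finite K" and I: "I \<subseteq> K" "I \<noteq> {}"
    and E: "E \<in> sets (clocks K)" and E': "\<And>m. m \<in> I \<Longrightarrow> E' m \<in> sets (clocks (K - {m}))"
    and shift: "\<And>m s y. m \<in> I \<Longrightarrow> s > 0 \<Longrightarrow> y \<in> space (clocks (K - {m})) \<Longrightarrow> (\<And>j. j \<in> K - {m} \<Longrightarrow> y j > 0) \<Longrightarrow>
        (\<lambda>j\<in>K. if j = m then s else if j \<in> I then y j + s else y j) \<in> E \<longleftrightarrow> y \<in> E' m"
  shows "measure (clocks K) E = (\<Sum>m\<in>I. r m / (\<Sum>j\<in>I. r j) * measure (clocks (K - {m})) (E' m))"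
proof -
  interpret P: prob_space "clocks L" for L by (intro prob_space_PiM prob_space_expo rate_pos)
  have finI: "finite I" using I K finite_subset by auto
  define R where "R = (\<Sum>j\<in>I. r j)"
  have R: "R > 0" unfolding R_def using finI I by (intro sum_pos rate_pos) auto
  \<comment> \<open>\<open>F m\<close> says that \<open>m\<close> rings first. Strict inequalities
    make these events disjoint; the ties that they miss are null.\<close>
  define F where "F m = {x :: 'i \<Rightarrow> real. \<forall>j\<in>I - {m}. x j > x m}" for m :: 'i
  have comp: "(\<lambda>x. x j) \<in> borel_measurable (clocks K)" if "j \<in> K" for j
    using that measurable_component_singleton[of j K "\<lambda>k. expo (r k)"] by (auto cong: measurable_cong_sets)
  have F: "{x \<in> space (clocks K). x \<in> F m} \<in> sets (clocks K)" if "m \<in> I" for m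
  proof -
    have "{x \<in> space (clocks K). x m < x j} \<in> sets (clocks K)" if "j \<in> I - {m}" for j
    proof -
      have "m \<in> K" by (rule subsetD[OF I(1) \<open>m \<in> I\<close>])
      moreover have "j \<in> K" using that by (intro subsetD[OF I(1)]) simp
      ultimately have *: "m \<in> K" "j \<in> K" .
      from borel_measurable_less[OF comp[OF *(1)] comp[OF *(2)]] show ?thesis .
    qed
    then show ?thesis
      unfolding F_def mem_Collect_eq using finI by (intro sets.sets_Collect_finite_All) auto
  qed
  then have Fm: "(\<lambda>x. indicator (F m) x :: ennreal) \<in> borel_measurable (clocks K)" if "m \<in> I" for m
    using that by (subst borel_measurable_indicator_iff) (auto simp: Int_def conj_commute)
  have "emeasure (clocks K) E = (\<integral>\<^sup>+x. indicator E x \<partial>clocks K)" using E by simp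
  also have "\<dots> = (\<integral>\<^sup>+x. (\<Sum>m\<in>I. indicator E x * indicator (F m) x) \<partial>clocks K)"
  proof (rule nn_integral_cong_AE)
    have "AE x in clocks K. \<forall>a\<in>I. \<forall>b\<in>I. a \<noteq> b \<longrightarrow> x a \<noteq> x b"
      using finI I K AE_clocks_distinct[OF K] by (intro AE_finite_allI) (auto simp: subset_eq)
    then show "AE x in clocks K. indicator E x = (\<Sum>m\<in>I. indicator E x * indicator (F m) x :: ennreal)"
    proof (rule AE_mp, intro AE_I2 impI)
      fix x :: "'i \<Rightarrow> real" assume d: "\<forall>a\<in>I. \<forall>b\<in>I. a \<noteq> b \<longrightarrow> x a \<noteq> x b"
      have "Min (x ` I) \<in> x ` I" using finI I(2) by (intro Min_in) auto
      then obtain m where m: "m \<in> I" "x m = Min (x ` I)" by auto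
      then have le: "x m \<le> x j" if "j \<in> I" for j using finI that by simp
      have lt: "x m < x j" if "j \<in> I" "j \<noteq> m" for j
      proof -
        have "x j \<noteq> x m" using d that m(1) by blast
        with le[OF that(1)] show ?thesis by simp
      qed
      have "x \<in> F m' \<longleftrightarrow> m' = m" if "m' \<in> I" for m'
      proof
        assume "x \<in> F m'"
        then have "m' \<noteq> m \<Longrightarrow> x m' < x m" using m(1) by (simp add: F_def)
        with lt[OF that] show "m' = m" by force
      next
        assume "m' = m"
        then show "x \<in> F m'" using lt by (simp add: F_def)
      qed
      then have "(\<Sum>m\<in>I. indicator E x * indicator (F m) x :: ennreal) = (\<Sum>m'\<in>I. if m' = m then indicator E x else 0)"
        by (intro sum.cong) (auto simp: indicator_def)
      then show "indicator E x = (\<Sum>m\<in>I. indicator E x * indicator (F m) x :: ennreal)"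
        using m finI by simp
    qed
  qed
  also have "\<dots> = (\<Sum>m\<in>I. \<integral>\<^sup>+x. indicator E x * indicator (F m) x \<partial>clocks K)"
    using E Fm by (intro nn_integral_sum borel_measurable_times) auto
  also have "\<dots> = (\<Sum>m\<in>I. ennreal (r m / R) * emeasure (clocks (K - {m})) (E' m))"
  proof (rule sum.cong)
    fix m assume m: "m \<in> I"
    have mK: "m \<in> K" using m I by auto
    have upd: "(\<lambda>y. y(m := s)) \<in> measurable (clocks (K - {m})) (clocks K)" for s
    proof (rule measurable_PiM_single')
      fix i assume "i \<in> K"
      then show "(\<lambda>y. (y(m := s)) i) \<in> measurable (clocks (K - {m})) (expo (r i))"
        by (cases "i = m") auto
    qed (use mK in \<open>auto simp: space_PiM PiE_def extensional_def\<close>)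
    let ?c = "emeasure (clocks (K - {m})) (E' m)"
    \<comment> \<open>Given that \<open>m\<close> rings at time \<open>s\<close>, the other running
      clocks have to exceed \<open>s\<close>. This costs their total rate \<open>R - r m\<close> and
      restarts them, and what then remains does not depend on \<open>s\<close>.\<close>
    have "(\<integral>\<^sup>+x. indicator E x * indicator (F m) x \<partial>clocks K) =
      (\<integral>\<^sup>+s. \<integral>\<^sup>+y. indicator E (y(m := s)) * indicator (F m) (y(m := s)) \<partial>clocks (K - {m}) \<partial>expo (r m))"
      using E Fm m mK K by (intro nn_integral_clocks_split(2) borel_measurable_times) auto
    also have "\<dots> = (\<integral>\<^sup>+s. ennreal (exp (- (R - r m) * s)) * ?c \<partial>expo (r m))"
    proof (rule nn_integral_cong_AE, rule AE_mp[OF AE_expo_pos[OF rate_pos]], intro AE_I2 impI)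
      fix s :: real assume s: "s > 0"
      have f: "(\<lambda>y. indicator E (y(m := s)) :: ennreal) \<in> borel_measurable (clocks (K - {m}))"
        by (rule measurable_compose[OF upd]) (use E in auto)
      have "(\<integral>\<^sup>+y. indicator E (y(m := s)) * indicator (F m) (y(m := s)) \<partial>clocks (K - {m})) =
        (\<integral>\<^sup>+y. indicator E (y(m := s)) * indicator {y. \<forall>j\<in>I - {m}. y j > s} y \<partial>clocks (K - {m}))"
        by (rule nn_integral_cong) (auto simp: F_def indicator_def)
      also have "\<dots> = ennreal (exp (- (\<Sum>j\<in>I - {m}. r j) * s)) *
         (\<integral>\<^sup>+y. indicator E ((\<lambda>j\<in>K - {m}. if j \<in> I - {m} then y j + s else y j)(m := s)) \<partial>clocks (K - {m}))"
        using K I s by (intro nn_integral_clocks_beyond[OF _ _ _ f]) auto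
      also have "(\<Sum>j\<in>I - {m}. r j) = R - r m"
        using finI m by (simp add: R_def sum_diff1)
      also have "(\<integral>\<^sup>+y. indicator E ((\<lambda>j\<in>K - {m}. if j \<in> I - {m} then y j + s else y j)(m := s)) \<partial>clocks (K - {m})) =
          (\<integral>\<^sup>+y. indicator (E' m) y \<partial>clocks (K - {m}))"
      proof (rule nn_integral_cong_AE, rule AE_mp[OF AE_clocks_pos], use K in simp, intro AE_I2 impI)
        fix y assume y: "y \<in> space (clocks (K - {m}))" "\<forall>j\<in>K - {m}. 0 < y j"
        have "(\<lambda>j\<in>K - {m}. if j \<in> I - {m} then y j + s else y j)(m := s) =
              (\<lambda>j\<in>K. if j = m then s else if j \<in> I then y j + s else y j)"
          using mK by auto
        then show "indicator E ((\<lambda>j\<in>K - {m}. if j \<in> I - {m} then y j + s else y j)(m := s)) =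
            (indicator (E' m) y :: ennreal)"
          using shift[OF m s y(1)] y(2) by (auto simp: indicator_def)
      qed
      also have "\<dots> = ?c" using E'[OF m] by simp
      finally show "(\<integral>\<^sup>+y. indicator E (y(m := s)) * indicator (F m) (y(m := s)) \<partial>clocks (K - {m})) =
        ennreal (exp (- (R - r m) * s)) * ?c" .
    qed
    also have "\<dots> = (\<integral>\<^sup>+s. ennreal (exp (- (R - r m) * s)) \<partial>expo (r m)) * ?c"
      by (rule nn_integral_multc) measurable
    also have "(\<integral>\<^sup>+s. ennreal (exp (- (R - r m) * s)) \<partial>expo (r m)) = ennreal (r m / R)"
    \<comment> \<open>\<open>exp (- (R - r m) * s)\<close> times the density of rate
      \<open>r m\<close> is \<open>r m / R\<close> times the density of rate \<open>R\<close>, the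
      law of the first ring.\<close>
    proof -
      have "(\<integral>\<^sup>+s. ennreal (exp (- (R - r m) * s)) \<partial>expo (r m)) =
        (\<integral>\<^sup>+s. ennreal (r m / R) * ennreal (exponential_density R s) \<partial>lborel)"
        using R rate_pos[of m]
        by (subst nn_integral_expo, measurable, intro nn_integral_cong)
          (auto simp: exponential_density_def ennreal_mult[symmetric] mult_exp_exp algebra_simps)
      also have "\<dots> = ennreal (r m / R) * emeasure (expo R) (space (expo R))"
        by (subst nn_integral_cmult) (auto simp: expo_def emeasure_density)
      also have "\<dots> = ennreal (r m / R)"
        using prob_space.emeasure_space_1[OF prob_space_expo[OF R]] by simp
      finally show ?thesis .
    qed
    finally show "(\<integral>\<^sup>+x. indicator E x * indicator (F m) x \<partial>clocks K) = ennreal (r m / R) * ?c" .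
  qed simp
  also have "\<dots> = ennreal (\<Sum>m\<in>I. r m / R * measure (clocks (K - {m})) (E' m))"
  proof -
    have "ennreal (r m / R) * emeasure (clocks (K - {m})) (E' m) =
        ennreal (r m / R * measure (clocks (K - {m})) (E' m))" for m
      using R rate_pos[of m] unfolding P.emeasure_eq_measure by (subst ennreal_mult) simp_all
    then have "(\<Sum>m\<in>I. ennreal (r m / R) * emeasure (clocks (K - {m})) (E' m)) =
        (\<Sum>m\<in>I. ennreal (r m / R * measure (clocks (K - {m})) (E' m)))"
      by (intro sum.cong) auto
    also have "\<dots> = ennreal (\<Sum>m\<in>I. r m / R * measure (clocks (K - {m})) (E' m))"
      using R rate_pos by (intro sum_ennreal) (simp add: less_imp_le)
    finally show ?thesis .
  qed
  finally show ?thesis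
    unfolding R_def[symmetric] using R rate_pos
    by (intro measure_eq_emeasure_eq_ennreal sum_nonneg) (auto simp: less_imp_le)
qed

end

subsection \<open>Sample paths of the queue\<close>

text \<open>In a sorted list the positions of the entries up to \<open>t\<close> form an initial
  segment, so its length decides.\<close>

lemma sorted_nth_le_iff:
  fixes t :: "'a :: linorder"
  assumes "sorted ys" "k < length ys"
  shows "ys ! k \<le> t \<longleftrightarrow> Suc k \<le> length (filter (\<lambda>y. y \<le> t) ys)"
proof -
  let ?S = "{j. j < length ys \<and> ys ! j \<le> t}"
  have len: "length (filter (\<lambda>y. y \<le> t) ys) = card ?S"
    by (rule length_filter_conv_card)
  show ?thesis
  proof
    assume "ys ! k \<le> t"
    then have "{..k} \<subseteq> ?S"
      using assms by (auto intro: order_trans[OF sorted_nth_mono])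
    then have "card {..k} \<le> card ?S" by (rule card_mono[rotated]) simp
    then show "Suc k \<le> length (filter (\<lambda>y. y \<le> t) ys)" using len by simp
  next
    assume *: "Suc k \<le> length (filter (\<lambda>y. y \<le> t) ys)"
    show "ys ! k \<le> t"
    proof (rule ccontr)
      assume "\<not> ys ! k \<le> t"
      then have "?S \<subseteq> {..<k}"
        using assms sorted_nth_mono[OF assms(1), of k] by (force simp: not_less[symmetric])
      then have "card ?S \<le> card {..<k}" by (rule card_mono[rotated]) simp
      with * len show False by simp
    qed
  qed
qed

text \<open>Trades the sorting in \<open>arrival_epoch\<close> for a count, which is symmetric in
  the customers and easy to follow when a clock is shifted or removed.\<close>

lemma arrival_epoch_le_iff:
  assumes "1 \<le> k" "k \<le> N"
  shows "arrival_epoch N T k \<le> t \<longleftrightarrow> k \<le> num_arrived N T t"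
proof -
  let ?xs = "map T [1..<Suc N]"
  have "length (filter (\<lambda>y. y \<le> t) (sort ?xs)) = length (filter (\<lambda>y. y \<le> t) ?xs)"
    by (simp only: filter_sort length_sort)
  also have "\<dots> = length (filter (\<lambda>j. T j \<le> t) [1..<Suc N])"
    by (simp only: filter_map length_map o_def)
  also have "\<dots> = card (set (filter (\<lambda>j. T j \<le> t) [1..<Suc N]))"
    by (rule distinct_card[symmetric]) simp
  also have "set (filter (\<lambda>j. T j \<le> t) [1..<Suc N]) = {j \<in> {1..N}. T j \<le> t}"
    by auto
  finally have "length (filter (\<lambda>y. y \<le> t) (sort ?xs)) = num_arrived N T t"
    by (simp only: num_arrived_def)
  moreover have "sorted (sort ?xs)" "k - 1 < length (sort ?xs)" using assms by simp_all
  ultimately show ?thesis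
    using sorted_nth_le_iff[of "sort ?xs" "k - 1" t] assms unfolding arrival_epoch_def by simp
qed

lemma num_arrived_le: "num_arrived N T t \<le> N"
proof -
  have "card {j \<in> {1..N}. T j \<le> t} \<le> card {1..N}" by (rule card_mono) auto
  then show ?thesis by (simp add: num_arrived_def)
qed

lemma first_arrival_epoch:
  assumes m: "m \<in> {1..N}" and min: "\<And>j. j \<in> {1..N} \<Longrightarrow> T m \<le> T j"
  shows "arrival_epoch N T 1 = T m"
proof -
  have N: "1 \<le> N" using m by simp
  have "num_arrived N T t = 0" if "t < T m" for t
    using min that by (force simp: num_arrived_def)
  then have "T m \<le> arrival_epoch N T 1"
    using arrival_epoch_le_iff[of 1 N T "arrival_epoch N T 1"] N by (intro leI notI) simp
  moreover have "num_arrived N T (T m) \<ge> 1"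
    using m by (auto simp: num_arrived_def Suc_le_eq card_gt_0_iff)
  then have "arrival_epoch N T 1 \<le> T m"
    using arrival_epoch_le_iff[of 1 N T "T m"] N by simp
  ultimately show ?thesis by simp
qed

lemma departure_epoch_ge_arrival:
  assumes "1 \<le> k" "V k > 0"
  shows "arrival_epoch N T k \<le> departure_epoch N T V k"
  using assms by (cases k) auto

context
  fixes N :: nat and T V :: "nat \<Rightarrow> real"
  assumes V: "\<And>k. k \<in> {1..N} \<Longrightarrow> V k > 0"
begin

lemma departure_epoch_strict_mono:
  assumes "k < l" "l \<le> N"
  shows "departure_epoch N T V k < departure_epoch N T V l"
  using assms
proof (induction l)
  case (Suc l)
  have "V (Suc l) > 0" using Suc.prems by (intro V) simp
  then have "departure_epoch N T V l < departure_epoch N T V (Suc l)" by simp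
  moreover have "departure_epoch N T V k \<le> departure_epoch N T V l"
    using Suc by (cases "k = l") auto
  ultimately show ?case by simp
qed simp

lemma departure_epoch_le_iff:
  assumes "k \<le> N" "l \<le> N"
  shows "departure_epoch N T V k \<le> departure_epoch N T V l \<longleftrightarrow> k \<le> l"
  using departure_epoch_strict_mono[of k l] departure_epoch_strict_mono[of l k] assms
  by (cases k l rule: linorder_cases) auto

lemma num_served_departure:
  assumes "k \<le> N"
  shows "num_served N T V (departure_epoch N T V k) = k"
proof -
  have "{k' \<in> {1..N}. departure_epoch N T V k' \<le> departure_epoch N T V k} = {1..k}"
    using assms by (auto simp: departure_epoch_le_iff)
  then show ?thesis by (simp add: num_served_def)
qed

lemma num_arrived_departure_ge:
  assumes "1 \<le> k" "k \<le> N"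
  shows "k \<le> num_arrived N T (departure_epoch N T V k)"
  using arrival_epoch_le_iff[of k N T "departure_epoch N T V k"] departure_epoch_ge_arrival[of k V N T] V[of k] assms
  by simp

text \<open>At a departure the services never exceed the arrivals, and the system is empty exactly
  when they agree. Departure epochs increase strictly, so the earliest such epoch has the smallest
  index, and that index is the number served.\<close>

lemma first_busy_served_iff_departure:
  assumes "i \<in> {1..N}"
  shows "first_busy_served N T V = i \<longleftrightarrow>
    (\<forall>l\<in>{1..<i}. l < num_arrived N T (departure_epoch N T V l)) \<and>
    num_arrived N T (departure_epoch N T V i) = i"
proof -
  let ?D = "departure_epoch N T V"
  define Q where "Q = {k \<in> {1..N}. num_arrived N T (?D k) = k}"
  \<comment> \<open>The last departure leaves the system empty, so the minimum is over a nonempty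
    set.\<close>
  have "N \<in> Q"
    using assms num_arrived_departure_ge[of N] num_arrived_le[of N T "?D N"] by (simp add: Q_def)
  then have Q: "finite Q" "Q \<noteq> {}" by (auto simp: Q_def)
  define n where "n = Min Q"
  have n: "n \<in> Q" "\<And>k. k \<in> Q \<Longrightarrow> n \<le> k" using Q by (auto simp: n_def)
  have "{t \<in> ?D ` {1..N}. num_served N T V t = num_arrived N T t} = ?D ` Q"
    by (auto simp: Q_def num_served_departure)
  then have "first_busy_end N T V = Min (?D ` Q)" by (simp add: first_busy_end_def)
  also have "\<dots> = ?D n"
    using Q n by (intro Min_eqI) (auto simp: departure_epoch_le_iff Q_def)
  finally have "first_busy_served N T V = n"
    using n(1) by (simp add: first_busy_served_def num_served_departure Q_def)
  moreover have "n = i \<longleftrightarrow> i \<in> Q \<and> (\<forall>l\<in>{1..<i}. l \<notin> Q)"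
  proof
    assume "n = i"
    then show "i \<in> Q \<and> (\<forall>l\<in>{1..<i}. l \<notin> Q)"
      using n by (meson atLeastLessThan_iff not_less)
  next
    assume *: "i \<in> Q \<and> (\<forall>l\<in>{1..<i}. l \<notin> Q)"
    then have "n \<le> i" "n \<ge> 1" using n by (auto simp: Q_def)
    with * n(1) show "n = i" by force
  qed
  moreover have "l \<notin> Q \<longleftrightarrow> l < num_arrived N T (?D l)" if "l \<in> {1..<i}" for l
    using num_arrived_departure_ge[of l] that assms by (auto simp: Q_def)
  ultimately show ?thesis using assms by (auto simp: Q_def)
qed

text \<open>As long as the server stays busy, departures follow each other without idle time.\<close>
lemma first_busy_served_iff:
  assumes T: "\<And>j. j \<in> {1..N} \<Longrightarrow> T j > 0"
    and m: "m \<in> {1..N}" and min: "\<And>j. j \<in> {1..N} \<Longrightarrow> T m \<le> T j" and i: "i \<in> {1..N}"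
  shows "first_busy_served N T V = i \<longleftrightarrow>
    (\<forall>l\<in>{1..<i}. l < num_arrived N T (T m + sum V {1..l})) \<and>
    num_arrived N T (T m + sum V {1..i}) = i"
proof -
  let ?D = "departure_epoch N T V" and ?d = "\<lambda>l. T m + sum V {1..l}"
  have A: "arrival_epoch N T 1 = T m" using m min by (rule first_arrival_epoch)
  \<comment> \<open>The disjunction serves both directions of the equivalence: one knows that the
    server stays busy at the epochs \<open>?D k\<close>, the other at \<open>?d k\<close>, and by
    induction these coincide.\<close>
  have D: "?D l = ?d l"
    if "1 \<le> l" "l \<le> N" "\<And>k. k \<in> {1..<l} \<Longrightarrow> k < num_arrived N T (?D k) \<or> k < num_arrived N T (?d k)" for l
    using that
  proof (induction l)
    case (Suc l)
    show ?case
    proof (cases "l = 0")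
      case True
      then show ?thesis using A T[OF m] by simp
    next
      case False
      then have eq: "?D l = ?d l" using Suc by simp
      then have "Suc l \<le> num_arrived N T (?D l)" using Suc.prems(3)[of l] False by auto
      then have "arrival_epoch N T (Suc l) \<le> ?D l"
        using arrival_epoch_le_iff[of "Suc l" N T "?D l"] Suc.prems by simp
      then show ?thesis using eq by simp
    qed
  qed simp
  show ?thesis (is "_ \<longleftrightarrow> ?R")
  proof
    assume "first_busy_served N T V = i"
    then have *: "\<forall>l\<in>{1..<i}. l < num_arrived N T (?D l)" "num_arrived N T (?D i) = i"
      using first_busy_served_iff_departure[OF i] by auto
    have "?D l = ?d l" if "l \<in> {1..i}" for l using that * i by (intro D) auto
    with * i show ?R by auto
  next
    assume *: ?R
    then have "?D l = ?d l" if "l \<in> {1..i}" for l using that i by (intro D) auto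
    with * i show "first_busy_served N T V = i" by (subst first_busy_served_iff_departure[OF i]) auto
  qed
qed

end

section \<open>Measurability of the queue functionals\<close>

lemma sets_Collect_nat_eq:
  fixes a b :: "'a \<Rightarrow> nat"
  assumes "a \<in> measurable M (count_space UNIV)" "b \<in> measurable M (count_space UNIV)"
  shows "{\<omega> \<in> space M. a \<omega> = b \<omega>} \<in> sets M" "{\<omega> \<in> space M. a \<omega> \<noteq> b \<omega>} \<in> sets M"
proof -
  have "{\<omega> \<in> space M. a \<omega> = b \<omega>} = (\<Union>n. (a -` {n} \<inter> space M) \<inter> (b -` {n} \<inter> space M))"
    by auto
  also have "\<dots> \<in> sets M"
    using assms by (intro sets.countable_UN' sets.Int measurable_sets) auto
  finally show "{\<omega> \<in> space M. a \<omega> = b \<omega>} \<in> sets M" .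
  then show "{\<omega> \<in> space M. a \<omega> \<noteq> b \<omega>} \<in> sets M" by (rule sets.sets_Collect_neg)
qed

context
  fixes M :: "'a measure" and N :: nat and T V :: "nat \<Rightarrow> 'a \<Rightarrow> real"
  assumes T: "\<And>j. j \<in> {1..N} \<Longrightarrow> T j \<in> borel_measurable M"
    and V: "\<And>k. k \<in> {1..N} \<Longrightarrow> V k \<in> borel_measurable M"
begin

lemma measurable_num_arrived:
  assumes [measurable]: "t \<in> borel_measurable M"
  shows "(\<lambda>\<omega>. num_arrived N (\<lambda>j. T j \<omega>) (t \<omega>)) \<in> measurable M (count_space UNIV)"
  unfolding num_arrived_def
proof (rule measurable_card)
  fix j
  show "{\<omega> \<in> space M. j \<in> {j \<in> {1..N}. T j \<omega> \<le> t \<omega>}} \<in> sets M"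
  proof (cases "j \<in> {1..N}")
    case True
    note [measurable] = T[OF True]
    have "{\<omega> \<in> space M. T j \<omega> \<le> t \<omega>} \<in> sets M" by measurable
    then show ?thesis using True by simp
  next
    case False
    then have "{\<omega> \<in> space M. j \<in> {j \<in> {1..N}. T j \<omega> \<le> t \<omega>}} = {}" by blast
    then show ?thesis by (simp only: sets.empty_sets)
  qed
qed

lemma measurable_arrival_epoch:
  assumes "1 \<le> k" "k \<le> N"
  shows "(\<lambda>\<omega>. arrival_epoch N (\<lambda>j. T j \<omega>) k) \<in> borel_measurable M"
  unfolding borel_measurable_iff_le
proof
  fix a
  have [measurable]: "(\<lambda>\<omega>. num_arrived N (\<lambda>j. T j \<omega>) a) \<in> measurable M (count_space UNIV)"
    by (rule measurable_num_arrived) simp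
  show "{\<omega> \<in> space M. arrival_epoch N (\<lambda>j. T j \<omega>) k \<le> a} \<in> sets M"
    unfolding arrival_epoch_le_iff[OF assms] by measurable
qed

lemma measurable_departure_epoch:
  "k \<le> N \<Longrightarrow> (\<lambda>\<omega>. departure_epoch N (\<lambda>j. T j \<omega>) (\<lambda>k. V k \<omega>) k) \<in> borel_measurable M"
proof (induction k)
  case (Suc k)
  then have [measurable]: "(\<lambda>\<omega>. departure_epoch N (\<lambda>j. T j \<omega>) (\<lambda>k. V k \<omega>) k) \<in> borel_measurable M"
    "(\<lambda>\<omega>. arrival_epoch N (\<lambda>j. T j \<omega>) (Suc k)) \<in> borel_measurable M" "V (Suc k) \<in> borel_measurable M"
    by (auto intro!: measurable_arrival_epoch V)
  show ?case by simp
qed simp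

lemma measurable_num_served:
  assumes [measurable]: "t \<in> borel_measurable M"
  shows "(\<lambda>\<omega>. num_served N (\<lambda>j. T j \<omega>) (\<lambda>k. V k \<omega>) (t \<omega>)) \<in> measurable M (count_space UNIV)"
  unfolding num_served_def
proof (rule measurable_card)
  fix k
  show "{\<omega> \<in> space M. k \<in> {k \<in> {1..N}. departure_epoch N (\<lambda>j. T j \<omega>) (\<lambda>k. V k \<omega>) k \<le> t \<omega>}} \<in> sets M"
  proof (cases "k \<in> {1..N}")
    case True
    then have [measurable]: "(\<lambda>\<omega>. departure_epoch N (\<lambda>j. T j \<omega>) (\<lambda>k. V k \<omega>) k) \<in> borel_measurable M"
      by (intro measurable_departure_epoch) simp
    have "{\<omega> \<in> space M. departure_epoch N (\<lambda>j. T j \<omega>) (\<lambda>k. V k \<omega>) k \<le> t \<omega>} \<in> sets M" by measurable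
    then show ?thesis using True by simp
  next
    case False
    then have "{\<omega> \<in> space M. k \<in> {k \<in> {1..N}. departure_epoch N (\<lambda>j. T j \<omega>) (\<lambda>k. V k \<omega>) k \<le> t \<omega>}} = {}" by blast
    then show ?thesis by (simp only: sets.empty_sets)
  qed
qed

lemma measurable_Min_image:
  fixes f :: "nat \<Rightarrow> 'a \<Rightarrow> real"
  assumes "finite Z" "Z \<noteq> {}" "\<And>k. k \<in> Z \<Longrightarrow> f k \<in> borel_measurable M"
  shows "(\<lambda>\<omega>. Min ((\<lambda>k. f k \<omega>) ` Z)) \<in> borel_measurable M"
  using assms
proof (induction Z rule: finite_ne_induct)
  case (insert k Z)
  then have [measurable]: "(\<lambda>\<omega>. Min ((\<lambda>k. f k \<omega>) ` Z)) \<in> borel_measurable M" "f k \<in> borel_measurable M" by auto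
  show ?case using insert.hyps by simp
qed simp

text \<open>The index set of the minimum is random but has finitely many possible values, so
  measurability is checked for each value separately.\<close>

lemma measurable_first_busy_end:
  "(\<lambda>\<omega>. first_busy_end N (\<lambda>j. T j \<omega>) (\<lambda>k. V k \<omega>)) \<in> borel_measurable M"
proof -
  define D where "D k \<omega> = departure_epoch N (\<lambda>j. T j \<omega>) (\<lambda>k. V k \<omega>) k" for k \<omega>
  define Q where "Q \<omega> = {k \<in> {1..N}. num_served N (\<lambda>j. T j \<omega>) (\<lambda>k. V k \<omega>) (D k \<omega>) = num_arrived N (\<lambda>j. T j \<omega>) (D k \<omega>)}" for \<omega>
  have D: "D k \<in> borel_measurable M" if "k \<in> {1..N}" for k
    unfolding D_def using that by (intro measurable_departure_epoch) simp
  have eq: "first_busy_end N (\<lambda>j. T j \<omega>) (\<lambda>k. V k \<omega>) = Min ((\<lambda>k. D k \<omega>) ` Q \<omega>)" for \<omega>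
    unfolding first_busy_end_def Q_def D_def by (rule arg_cong[where f = Min]) auto
  have Q: "Q \<in> measurable M (count_space (Pow {1..N}))"
    unfolding measurable_count_space_eq2[OF finite_Pow_iff[THEN iffD2, OF finite_atLeastAtMost]]
  proof (intro conjI ballI)
    fix Z assume Z: "Z \<in> Pow {1..N}"
    have "Q -` {Z} \<inter> space M = {\<omega> \<in> space M. \<forall>k\<in>{1..N}. k \<in> Q \<omega> \<longleftrightarrow> k \<in> Z}"
    proof -
      have "Q \<omega> = Z \<longleftrightarrow> (\<forall>k\<in>{1..N}. k \<in> Q \<omega> \<longleftrightarrow> k \<in> Z)" for \<omega>
      proof -
        have "Q \<omega> \<subseteq> {1..N}" unfolding Q_def by blast
        then show ?thesis using Z by blast
      qed
      then show ?thesis by blast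
    qed
    also have "\<dots> \<in> sets M"
    proof (rule sets.sets_Collect_finite_All)
      fix k assume k: "k \<in> {1..N}"
      note meas = measurable_num_served[OF D[OF k]] measurable_num_arrived[OF D[OF k]]
      have "{\<omega> \<in> space M. num_served N (\<lambda>j. T j \<omega>) (\<lambda>k. V k \<omega>) (D k \<omega>) = num_arrived N (\<lambda>j. T j \<omega>) (D k \<omega>)} \<in> sets M"
        "{\<omega> \<in> space M. num_served N (\<lambda>j. T j \<omega>) (\<lambda>k. V k \<omega>) (D k \<omega>) \<noteq> num_arrived N (\<lambda>j. T j \<omega>) (D k \<omega>)} \<in> sets M"
        by (rule sets_Collect_nat_eq[OF meas])+
      then show "{\<omega> \<in> space M. k \<in> Q \<omega> \<longleftrightarrow> k \<in> Z} \<in> sets M"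
        using k by (cases "k \<in> Z") (simp_all add: Q_def)
    qed simp
    finally show "Q -` {Z} \<inter> space M \<in> sets M" .
  qed (auto simp: Q_def)
  show ?thesis unfolding eq
  proof (rule measurable_compose_countable'[OF _ Q])
    fix Z assume Z: "Z \<in> Pow {1..N}"
    show "(\<lambda>\<omega>. Min ((\<lambda>k. D k \<omega>) ` Z)) \<in> borel_measurable M"
    \<comment> \<open>For empty \<open>Z\<close> the map is the constant
      \<open>Min {}\<close>.\<close>
    proof (cases "Z = {}")
      case False
      then show ?thesis using Z D by (intro measurable_Min_image) (auto intro: finite_subset)
    qed simp
  qed (simp add: countable_finite)
qed

lemma measurable_first_busy_served:
  "(\<lambda>\<omega>. first_busy_served N (\<lambda>j. T j \<omega>) (\<lambda>k. V k \<omega>)) \<in> measurable M (count_space UNIV)"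
  unfolding first_busy_served_def by (rule measurable_num_served[OF measurable_first_busy_end])

end

subsection \<open>The law of the first busy period\<close>

text \<open>The event that the first busy period serves \<open>i\<close> customers, seen from a state in which \<open>k\<close>
  services are completed, the customers in \<open>R\<close> are still to arrive and service \<open>k + 1\<close> is in
  progress; all times are counted from that moment.\<close>
definition busy_event :: "nat \<Rightarrow> nat \<Rightarrow> nat set \<Rightarrow> nat \<Rightarrow> (nat + nat \<Rightarrow> real) \<Rightarrow> bool" where
  "busy_event N i R k x \<longleftrightarrow>
     (\<forall>l\<in>{k..<i}. l < N - card R + card {j \<in> R. x (Inl j) \<le> (\<Sum>v=Suc k..l. x (Inr v))}) \<and>
     N - card R + card {j \<in> R. x (Inl j) \<le> (\<Sum>v=Suc k..i. x (Inr v))} = i"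

text \<open>Arrival clocks are indexed by \<open>Inl\<close>, service clocks by \<open>Inr\<close>,
  so that both kinds race in one product measure.\<close>

locale queue_clocks =
  fixes N :: nat and lam mu :: real
  assumes lam: "lam > 0" and mu: "mu > 0"
begin

sublocale exponential_clocks "case_sum (\<lambda>_::nat. lam) (\<lambda>_::nat. mu)"
  by standard (auto split: sum.split simp: lam mu)

lemma measurable_clock:
  "m \<in> K \<Longrightarrow> (\<lambda>x. x m) \<in> borel_measurable (clocks K)"
  using measurable_component_singleton[of m K "\<lambda>k. expo (case_sum (\<lambda>_. lam) (\<lambda>_. mu) k)"]
  by (auto cong: measurable_cong_sets)

lemma sets_busy_event:
  assumes "finite R" "i \<le> N"
  shows "{x \<in> space (clocks (R <+> {Suc k..N})). busy_event N i R k x} \<in> sets (clocks (R <+> {Suc k..N}))"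
proof -
  let ?M = "clocks (R <+> {Suc k..N})"
  let ?c = "\<lambda>l x. N - card R + card {j \<in> R. x (Inl j) \<le> (\<Sum>v=Suc k..l. x (Inr v))}"
  have c: "?c l \<in> measurable ?M (count_space UNIV)" if "l \<le> N" for l
  proof -
    have s: "(\<lambda>x. \<Sum>v=Suc k..l. x (Inr v)) \<in> borel_measurable ?M"
      using that by (intro borel_measurable_sum measurable_clock) auto
    have "(\<lambda>x. card {j \<in> R. x (Inl j) \<le> (\<Sum>v=Suc k..l. x (Inr v))}) \<in> measurable ?M (count_space UNIV)"
    proof (rule measurable_card)
      fix j
      show "{x \<in> space ?M. j \<in> {j \<in> R. x (Inl j) \<le> (\<Sum>v=Suc k..l. x (Inr v))}} \<in> sets ?M"
      proof (cases "j \<in> R")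
        case True
        then have "(\<lambda>x. x (Inl j)) \<in> borel_measurable ?M" by (intro measurable_clock) auto
        from borel_measurable_le[OF this s] show ?thesis using True by simp
      next
        case False
        then have "{x \<in> space ?M. j \<in> {j \<in> R. x (Inl j) \<le> (\<Sum>v=Suc k..l. x (Inr v))}} = {}" by blast
        then show ?thesis by (simp only: sets.empty_sets)
      qed
    qed
    then show ?thesis by (rule measurable_compose) simp
  qed
  have "{x \<in> space ?M. \<forall>l\<in>{k..<i}. l < ?c l x} \<in> sets ?M"
  proof (rule sets.sets_Collect_finite_All)
    fix l assume "l \<in> {k..<i}"
    then have "?c l \<in> measurable ?M (count_space UNIV)" using assms by (intro c) simp
    from measurable_sets[OF this, of "{l<..}"] show "{x \<in> space ?M. l < ?c l x} \<in> sets ?M"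
      by (simp add: vimage_def Int_def conj_commute)
  qed simp
  moreover have "{x \<in> space ?M. ?c i x = i} \<in> sets ?M"
    using measurable_sets[OF c[OF assms(2)], of "{i}"] by (simp add: vimage_def Int_def conj_commute)
  ultimately have "{x \<in> space ?M. \<forall>l\<in>{k..<i}. l < ?c l x} \<inter> {x \<in> space ?M. ?c i x = i} \<in> sets ?M"
    by (rule sets.Int)
  then show ?thesis by (simp add: busy_event_def Int_def conj_ac)
qed

text \<open>Moving the origin of time to the departure subtracts \<open>s\<close> from both sides of
  every comparison of an arrival with a later departure. Later services have not started and keep
  their length. The clause \<open>l = k\<close> drops out because
  \<open>k < N - card R\<close>.\<close>

lemma busy_event_departure:
  fixes y :: "nat + nat \<Rightarrow> real" and s :: real
  assumes k: "k < i" "i \<le> N" "k < N - card R"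
  defines "x \<equiv> \<lambda>m\<in>R <+> {Suc k..N}. if m = Inr (Suc k) then s
     else if m \<in> insert (Inr (Suc k)) (Inl ` R) then y m + s else y m"
  shows "busy_event N i R k x \<longleftrightarrow> busy_event N i R (Suc k) y"
proof -
  have xl: "x (Inl j) = y (Inl j) + s" if "j \<in> R" for j using that by (auto simp: x_def)
  have sm: "(\<Sum>v=Suc k..l. x (Inr v)) = s + (\<Sum>v=Suc (Suc k)..l. y (Inr v))" if "k < l" "l \<le> N" for l
  proof -
    have "(\<Sum>v=Suc k..l. x (Inr v)) = x (Inr (Suc k)) + (\<Sum>v=Suc (Suc k)..l. x (Inr v))"
      using that by (intro sum.atLeast_Suc_atMost) simp
    also have "x (Inr (Suc k)) = s" using that by (auto simp: x_def)
    also have "(\<Sum>v=Suc (Suc k)..l. x (Inr v)) = (\<Sum>v=Suc (Suc k)..l. y (Inr v))"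
      using that by (intro sum.cong) (auto simp: x_def)
    finally show ?thesis .
  qed
  have c: "{j \<in> R. x (Inl j) \<le> (\<Sum>v=Suc k..l. x (Inr v))} =
      {j \<in> R. y (Inl j) \<le> (\<Sum>v=Suc (Suc k)..l. y (Inr v))}" if "k < l" "l \<le> N" for l
    using xl sm[OF that] by auto
  have ki: "{k..<i} = insert k {Suc k..<i}" using k by auto
  have "(\<forall>l\<in>{k..<i}. l < N - card R + card {j \<in> R. x (Inl j) \<le> (\<Sum>v=Suc k..l. x (Inr v))}) \<longleftrightarrow>
    (\<forall>l\<in>{Suc k..<i}. l < N - card R + card {j \<in> R. x (Inl j) \<le> (\<Sum>v=Suc k..l. x (Inr v))})"
    unfolding ki using trans_less_add1[OF k(3)] by blast
  also have "\<dots> \<longleftrightarrow>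
    (\<forall>l\<in>{Suc k..<i}. l < N - card R + card {j \<in> R. y (Inl j) \<le> (\<Sum>v=Suc (Suc k)..l. y (Inr v))})"
    using c k by (intro ball_cong) auto
  finally show ?thesis using c[of i] k by (simp add: busy_event_def)
qed

text \<open>Customer \<open>a\<close> moves from the counted set into the constant
  \<open>N - card (R - {a})\<close>, so the totals agree; the service in progress has the residual
  time \<open>y (Inr (Suc k))\<close>.\<close>

lemma busy_event_arrival:
  fixes y :: "nat + nat \<Rightarrow> real" and s :: real
  assumes R: "R \<subseteq> {1..N}" and k: "k < i" "i \<le> N" "k < N - card R" and a: "a \<in> R"
    and pos: "\<And>v. v \<in> {Suc k..N} \<Longrightarrow> y (Inr v) > 0"
  defines "x \<equiv> \<lambda>m\<in>R <+> {Suc k..N}. if m = Inl a then s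
     else if m \<in> insert (Inr (Suc k)) (Inl ` R) then y m + s else y m"
  shows "busy_event N i R k x \<longleftrightarrow> busy_event N i (R - {a}) k y"
proof -
  have fin: "finite R" using R finite_subset by blast
  have xl: "x (Inl j) = (if j = a then s else y (Inl j) + s)" if "j \<in> R" for j using that by (auto simp: x_def)
  have sm: "(\<Sum>v=Suc k..l. x (Inr v)) = s + (\<Sum>v=Suc k..l. y (Inr v))" if "k < l" "l \<le> N" for l
  proof -
    have "(\<Sum>v=Suc k..l. x (Inr v)) = x (Inr (Suc k)) + (\<Sum>v=Suc (Suc k)..l. x (Inr v))"
      using that by (intro sum.atLeast_Suc_atMost) simp
    also have "x (Inr (Suc k)) = y (Inr (Suc k)) + s" using that by (auto simp: x_def)
    also have "(\<Sum>v=Suc (Suc k)..l. x (Inr v)) = (\<Sum>v=Suc (Suc k)..l. y (Inr v))"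
      using that by (intro sum.cong) (auto simp: x_def)
    also have "y (Inr (Suc k)) + s + (\<Sum>v=Suc (Suc k)..l. y (Inr v)) = s + (\<Sum>v=Suc k..l. y (Inr v))"
      using that by (subst (2) sum.atLeast_Suc_atMost) simp_all
    finally show ?thesis .
  qed
  have cR: "card R \<le> N" "card R \<ge> 1"
    using R a card_mono[OF _ R] fin by (auto simp: Suc_le_eq card_gt_0_iff)
  have c: "N - card R + card {j \<in> R. x (Inl j) \<le> (\<Sum>v=Suc k..l. x (Inr v))} =
      N - card (R - {a}) + card {j \<in> R - {a}. y (Inl j) \<le> (\<Sum>v=Suc k..l. y (Inr v))}" if "k < l" "l \<le> N" for l
  proof -
    \<comment> \<open>The arrival at \<open>s\<close> precedes every later departure because the
      remaining service times sum to a nonnegative number; so \<open>a\<close> is always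
      counted.\<close>
    have "(\<Sum>v=Suc k..l. y (Inr v)) \<ge> 0"
      using that pos by (intro sum_nonneg) (auto intro: less_imp_le)
    then have "{j \<in> R. x (Inl j) \<le> (\<Sum>v=Suc k..l. x (Inr v))} =
        insert a {j \<in> R - {a}. y (Inl j) \<le> (\<Sum>v=Suc k..l. y (Inr v))}"
      using xl sm[OF that] a by auto
    then show ?thesis using fin a cR by (simp add: card_Diff_singleton)
  qed
  have ki: "{k..<i} = insert k {Suc k..<i}" using k by auto
  have "(\<forall>l\<in>{k..<i}. l < N - card R + card {j \<in> R. x (Inl j) \<le> (\<Sum>v=Suc k..l. x (Inr v))}) \<longleftrightarrow>
    (\<forall>l\<in>{Suc k..<i}. l < N - card R + card {j \<in> R. x (Inl j) \<le> (\<Sum>v=Suc k..l. x (Inr v))})"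
    unfolding ki using trans_less_add1[OF k(3)] by blast
  also have "\<dots> \<longleftrightarrow>
    (\<forall>l\<in>{Suc k..<i}. l < N - card (R - {a}) + card {j \<in> R - {a}. y (Inl j) \<le> (\<Sum>v=Suc k..l. y (Inr v))})"
    using c k by (intro ball_cong) auto
  also have "\<dots> \<longleftrightarrow>
    (\<forall>l\<in>{k..<i}. l < N - card (R - {a}) + card {j \<in> R - {a}. y (Inl j) \<le> (\<Sum>v=Suc k..l. y (Inr v))})"
  proof -
    have "k < N - card (R - {a})" using k fin a cR by (simp add: card_Diff_singleton)
    from trans_less_add1[OF this] show ?thesis unfolding ki by blast
  qed
  finally show ?thesis using c[of i] k by (simp add: busy_event_def)
qed

text \<open>The customers still to arrive are exchangeable: the probability depends on
  \<open>R\<close> only through its size, which turns the race into the first-step equation of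
  \<open>hit\<close> at height \<open>N - card R\<close>.\<close>

lemma measure_busy_event:
  assumes "R \<subseteq> {1..N}" "k \<le> i" "i \<le> N" "k \<le> N - card R"
  shows "measure (clocks (R <+> {Suc k..N})) {x \<in> space (clocks (R <+> {Suc k..N})). busy_event N i R k x} =
    hit N (rho N lam mu) (\<lambda>l. of_bool (l = i)) k (N - card R)"
  using assms
proof (induction k "N - card R" arbitrary: R rule: lattice_induct[where N = N])
  case (step k)
  let ?K = "R <+> {Suc k..N}"
  let ?q = "hit N (rho N lam mu) (\<lambda>l. of_bool (l = i))"
  have fin: "finite R" using step.prems(1) finite_subset by blast
  have finK: "finite ?K" using fin by simp
  have cR: "card R \<le> N" using card_mono[OF _ step.prems(1)] by simp
  interpret P: prob_space "clocks ?K" by (intro prob_space_PiM prob_space_expo rate_pos)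
  consider "N - card R > i" | "k = N - card R" | "k < N - card R" "N - card R \<le> i"
    using step.prems by linarith
  then show ?case
  proof cases
    case 1
    then have "\<not> busy_event N i R k x" for x
      using trans_less_add1[OF 1] unfolding busy_event_def by (metis less_irrefl)
    moreover have "?q k (N - card R) = hit N (rho N lam mu) (\<lambda>_. 0) k (N - card R)"
      using 1 by (intro hit_cong) auto
    ultimately show ?thesis by (simp add: hit_zero)
  next
    case 2
    \<comment> \<open>At \<open>l = k\<close> the sum of services is empty and almost surely nobody
      in \<open>R\<close> has arrived by time 0. So the clause \<open>l = k\<close> fails if
      \<open>k < i\<close>, while for \<open>k = i\<close> the count is exactly
      \<open>i\<close>.\<close>
    have "AE x in clocks ?K. busy_event N i R k x \<longleftrightarrow> k = i"
      using AE_clocks_pos[OF finK]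
    proof eventually_elim
      fix x :: "nat + nat \<Rightarrow> real" assume "\<forall>j\<in>?K. 0 < x j"
      then have "{j \<in> R. x (Inl j) \<le> 0} = {}" by (auto simp: not_le)
      then have c: "card {j \<in> R. x (Inl j) \<le> 0} = 0" by (simp only: card.empty)
      show "busy_event N i R k x \<longleftrightarrow> k = i"
      proof (cases "k = i")
        case True
        then show ?thesis using c 2 by (simp add: busy_event_def)
      next
        case False
        then have "k \<in> {k..<i}" using step.prems by simp
        then show ?thesis using c 2 False by (auto simp: busy_event_def dest!: bspec[where x = k])
      qed
    qed
    then have "measure (clocks ?K) {x \<in> space (clocks ?K). busy_event N i R k x} =
        measure (clocks ?K) {x \<in> space (clocks ?K). k = i}"
      by (intro measure_eq_AE sets_busy_event fin step.prems) auto
    also have "\<dots> = of_bool (k = i)"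
      using P.prob_space by (cases "k = i") simp_all
    finally show ?thesis unfolding 2[symmetric] by simp
  next
    case 3
    define I :: "(nat + nat) set" where "I = insert (Inr (Suc k)) (Inl ` R)"
    define S where "S = real (card R) * lam + mu"
    have sumI: "(\<Sum>m\<in>I. f m) = f (Inr (Suc k)) + (\<Sum>a\<in>R. f (Inl a))" for f :: "nat + nat \<Rightarrow> real"
    proof -
      have "(\<Sum>m\<in>I. f m) = f (Inr (Suc k)) + (\<Sum>m\<in>Inl ` R. f m)"
        unfolding I_def using fin by (intro sum.insert) auto
      then show ?thesis by (simp add: sum.reindex)
    qed
    have S: "(\<Sum>m\<in>I. case_sum (\<lambda>_. lam) (\<lambda>_. mu) m) = S"
      by (simp add: sumI S_def)
    have Spos: "S > 0" using lam mu by (simp add: S_def add_nonneg_pos)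
    have ki: "k < i" using 3 by simp
    define E' where "E' m = (case m of
        Inl a \<Rightarrow> {x \<in> space (clocks ((R - {a}) <+> {Suc k..N})). busy_event N i (R - {a}) k x}
      | Inr (_::nat) \<Rightarrow> {x \<in> space (clocks (R <+> {Suc (Suc k)..N})). busy_event N i R (Suc k) x})" for m :: "nat + nat"
    have Kl: "?K - {Inl a} = (R - {a}) <+> {Suc k..N}" for a by auto
    have Kr: "?K - {Inr (Suc k)} = R <+> {Suc (Suc k)..N}"
      using atLeastAtMost_insertL[of "Suc k" N] by auto
    have IK: "I \<subseteq> ?K" using ki step.prems by (auto simp: I_def)
    have "measure (clocks ?K) {x \<in> space (clocks ?K). busy_event N i R k x} =
       (\<Sum>m\<in>I. case_sum (\<lambda>_. lam) (\<lambda>_. mu) m / (\<Sum>j\<in>I. case_sum (\<lambda>_. lam) (\<lambda>_. mu) j) * measure (clocks (?K - {m})) (E' m))"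
    proof (rule race[OF finK IK])
      show "I \<noteq> {}" by (simp add: I_def)
      show "{x \<in> space (clocks ?K). busy_event N i R k x} \<in> sets (clocks ?K)"
        by (intro sets_busy_event fin step.prems)
      show "E' m \<in> sets (clocks (?K - {m}))" if "m \<in> I" for m
        using that fin step.prems by (auto simp: I_def E'_def Kl Kr intro!: sets_busy_event)
      fix m and s :: real and y :: "nat + nat \<Rightarrow> real"
      assume m: "m \<in> I" and s: "s > 0" and y: "y \<in> space (clocks (?K - {m}))"
        and pos: "\<And>j. j \<in> ?K - {m} \<Longrightarrow> 0 < y j"
      let ?x = "\<lambda>j\<in>?K. if j = m then s else if j \<in> I then y j + s else y j"
      have x: "?x \<in> space (clocks ?K)" by (simp add: space_PiM)
      show "?x \<in> {x \<in> space (clocks ?K). busy_event N i R k x} \<longleftrightarrow> y \<in> E' m"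
      proof (cases m)
        case (Inl a)
        then have a: "a \<in> R" using m by (auto simp: I_def)
        have "busy_event N i R k ?x \<longleftrightarrow> busy_event N i (R - {a}) k y"
          unfolding Inl I_def
        proof (intro busy_event_arrival step.prems ki 3 a)
          fix v assume "v \<in> {Suc k..N}"
          then show "y (Inr v) > 0" using Inl by (intro pos) blast
        qed
        then show ?thesis using x y Inl by (simp add: E'_def Kl)
      next
        case (Inr v)
        then have v: "v = Suc k" using m by (auto simp: I_def)
        have "busy_event N i R k ?x \<longleftrightarrow> busy_event N i R (Suc k) y"
          unfolding Inr v I_def by (intro busy_event_departure step.prems ki 3)
        then show ?thesis using x y Inr v by (simp add: E'_def Kr)
      qed
    qed
    also have "\<dots> = mu / S * measure (clocks (?K - {Inr (Suc k)})) (E' (Inr (Suc k))) +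
        (\<Sum>a\<in>R. lam / S * measure (clocks (?K - {Inl a})) (E' (Inl a)))"
      unfolding S by (simp add: sumI)
    also have "measure (clocks (?K - {Inr (Suc k)})) (E' (Inr (Suc k))) = ?q (Suc k) (N - card R)"
      using step 3 ki by (simp add: Kr E'_def)
    \<comment> \<open>Each arrival leads to the same value; together they have rate
      \<open>card R * lam\<close>, the arrival rate at height \<open>N - card R\<close>.\<close>
    also have "(\<Sum>a\<in>R. lam / S * measure (clocks (?K - {Inl a})) (E' (Inl a))) =
        (\<Sum>a\<in>R. lam / S * ?q k (Suc (N - card R)))"
    proof (rule sum.cong)
      fix a assume a: "a \<in> R"
      then have "card R \<ge> 1" using fin by (auto simp: Suc_le_eq card_gt_0_iff)
      then have "N - card (R - {a}) = Suc (N - card R)" "N - card R < N"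
        using a fin cR by (auto simp: card_Diff_singleton)
      then show "lam / S * measure (clocks (?K - {Inl a})) (E' (Inl a)) = lam / S * ?q k (Suc (N - card R))"
        using step.hyps(2)[of "R - {a}"] step.prems 3 by (auto simp: Kl E'_def)
    qed simp
    also have "\<dots> = real (card R) * lam / S * ?q k (Suc (N - card R))" by simp
    also have "mu / S * ?q (Suc k) (N - card R) + real (card R) * lam / S * ?q k (Suc (N - card R)) = ?q k (N - card R)"
    proof -
      have r: "rho N lam mu (N - card R) = mu / S" "1 - rho N lam mu (N - card R) = real (card R) * lam / S"
        using cR Spos by (simp_all add: rho_def arr_rate_def S_def of_nat_diff field_simps)
      show ?thesis
      proof (cases "R = {}")
        \<comment> \<open>With nobody left to arrive only the service clock runs, in accordance with
          \<open>rho N lam mu N = 1\<close>.\<close>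
        case True
        then have "mu / S = 1" using mu by (simp add: S_def)
        then show ?thesis
          using True 3(1) hit_step_full[of k N "rho N lam mu"] rho_full[OF lam mu, of N] by simp
      next
        case False
        then have "N - card R < N" using fin cR card_gt_0_iff[of R] by linarith
        from hit_step[OF 3(1) this] show ?thesis
          by (simp only: r(2)[unfolded r(1)] r(1))
      qed
    qed
    finally show ?thesis .
  qed
qed

text \<open>Until the first arrival only the \<open>N\<close> arrival clocks run. Each wins with
  probability \<open>1 / N\<close>, and each outcome leads to the state \<open>(0, 1)\<close>, so
  the average is the common value.\<close>

lemma measure_first_busy_served:
  assumes i: "i \<in> {1..N}"
  shows "measure (clocks ({1..N} <+> {1..N}))
      {x \<in> space (clocks ({1..N} <+> {1..N})). first_busy_served N (\<lambda>j. x (Inl j)) (\<lambda>k. x (Inr k)) = i} =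
    hit N (rho N lam mu) (\<lambda>l. of_bool (l = i)) 0 1"
proof -
  let ?K = "{1..N} <+> {1..N}"
  define I :: "(nat + nat) set" where "I = Inl ` {1..N}"
  have S: "(\<Sum>m\<in>I. case_sum (\<lambda>_. lam) (\<lambda>_. mu) m) = N * lam"
    by (simp add: I_def sum.reindex)
  define E' where "E' m = (case m of
        Inl a \<Rightarrow> {x \<in> space (clocks (({1..N} - {a}) <+> {Suc 0..N})). busy_event N i ({1..N} - {a}) 0 x}
      | Inr (_::nat) \<Rightarrow> {})" for m :: "nat + nat"
  have Kl: "?K - {Inl a} = ({1..N} - {a}) <+> {Suc 0..N}" for a by auto
  have "measure (clocks ?K) {x \<in> space (clocks ?K). first_busy_served N (\<lambda>j. x (Inl j)) (\<lambda>k. x (Inr k)) = i} =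
      (\<Sum>m\<in>I. case_sum (\<lambda>_. lam) (\<lambda>_. mu) m / (\<Sum>j\<in>I. case_sum (\<lambda>_. lam) (\<lambda>_. mu) j) * measure (clocks (?K - {m})) (E' m))"
  proof (rule race)
    have "(\<lambda>x. first_busy_served N (\<lambda>j. x (Inl j)) (\<lambda>k. x (Inr k))) \<in> measurable (clocks ?K) (count_space UNIV)"
      by (intro measurable_first_busy_served measurable_clock) auto
    from measurable_sets[OF this, of "{i}"]
    show "{x \<in> space (clocks ?K). first_busy_served N (\<lambda>j. x (Inl j)) (\<lambda>k. x (Inr k)) = i} \<in> sets (clocks ?K)"
      by (simp add: vimage_def Int_def conj_commute)
    show "E' m \<in> sets (clocks (?K - {m}))" if mI: "m \<in> I" for m
    proof -
      obtain a where m: "m = Inl a" using mI by (auto simp: I_def)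
      show ?thesis unfolding m Kl E'_def sum.case using i by (intro sets_busy_event) auto
    qed
    fix m and s :: real and y :: "nat + nat \<Rightarrow> real"
    assume m: "m \<in> I" and s: "s > 0" and y: "y \<in> space (clocks (?K - {m}))"
      and pos: "\<And>j. j \<in> ?K - {m} \<Longrightarrow> 0 < y j"
    obtain a where a: "m = Inl a" "a \<in> {1..N}" using m by (auto simp: I_def)
    let ?x = "\<lambda>j\<in>?K. if j = m then s else if j \<in> I then y j + s else y j"
    have x: "?x \<in> space (clocks ?K)" by (simp add: space_PiM)
    have T: "?x (Inl j) = (if j = a then s else y (Inl j) + s)" if "j \<in> {1..N}" for j
      using that a by (auto simp: I_def)
    \<comment> \<open>No service has started before the first arrival, so the elapsed time is added
      to arrival clocks only.\<close>
    have V: "?x (Inr k) = y (Inr k)" if "k \<in> {1..N}" for k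
      using that a by (auto simp: I_def)
    have posT: "y (Inl j) > 0" if "j \<in> {1..N}" "j \<noteq> a" for j
      using that a(1) by (intro pos) blast
    have posV: "y (Inr k) > 0" if "k \<in> {1..N}" for k
      using that a(1) by (intro pos) blast
    have arr: "num_arrived N (\<lambda>j. ?x (Inl j)) (?x (Inl a) + (\<Sum>k=1..l. ?x (Inr k))) =
        N - card ({1..N} - {a}) + card {j \<in> {1..N} - {a}. y (Inl j) \<le> (\<Sum>v=Suc 0..l. y (Inr v))}" if "l \<le> N" for l
    proof -
      have sm: "(\<Sum>k=1..l. ?x (Inr k)) = (\<Sum>v=Suc 0..l. y (Inr v))"
        using that V by (intro sum.cong) auto
      have nonneg: "(\<Sum>v=Suc 0..l. y (Inr v)) \<ge> 0"
        using that by (intro sum_nonneg less_imp_le posV) auto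
      have "{j \<in> {1..N}. ?x (Inl j) \<le> ?x (Inl a) + (\<Sum>v=Suc 0..l. y (Inr v))} =
          insert a {j \<in> {1..N} - {a}. y (Inl j) \<le> (\<Sum>v=Suc 0..l. y (Inr v))}"
        using T a(2) nonneg by (auto simp del: restrict_apply)
      moreover have "N - card ({1..N} - {a}) = 1" using a by (simp add: card_Diff_singleton)
      ultimately show ?thesis unfolding num_arrived_def sm by simp
    qed
    have "first_busy_served N (\<lambda>j. ?x (Inl j)) (\<lambda>k. ?x (Inr k)) = i \<longleftrightarrow>
      (\<forall>l\<in>{1..<i}. l < num_arrived N (\<lambda>j. ?x (Inl j)) (?x (Inl a) + (\<Sum>k=1..l. ?x (Inr k)))) \<and>
      num_arrived N (\<lambda>j. ?x (Inl j)) (?x (Inl a) + (\<Sum>k=1..i. ?x (Inr k))) = i"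
    proof (rule first_busy_served_iff)
      show "?x (Inr k) > 0" if "k \<in> {1..N}" for k using V[OF that] posV[OF that] by simp
      show "?x (Inl j) > 0" if "j \<in> {1..N}" for j
        unfolding T[OF that] using posT[of j] that s by (auto simp: add_pos_pos)
      show "?x (Inl a) \<le> ?x (Inl j)" if "j \<in> {1..N}" for j
        unfolding T[OF that] T[OF a(2)] using posT[of j] that by (auto simp: less_imp_le)
    qed (use a i in auto)
    also have "\<dots> \<longleftrightarrow> busy_event N i ({1..N} - {a}) 0 y"
    proof -
      let ?c = "\<lambda>l. N - card ({1..N} - {a}) + card {j \<in> {1..N} - {a}. y (Inl j) \<le> (\<Sum>v=Suc 0..l. y (Inr v))}"
      \<comment> \<open>\<open>busy_event\<close> has a clause for \<open>l = 0\<close> that the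
        other side lacks; it holds because one customer is present.\<close>
      have "0 < ?c 0" using a by (simp add: card_Diff_singleton)
      moreover have "{0..<i} = insert 0 {1..<i}" using i by auto
      ultimately have "(\<forall>l\<in>{0..<i}. l < ?c l) \<longleftrightarrow> (\<forall>l\<in>{1..<i}. l < ?c l)" by simp
      moreover have "(\<forall>l\<in>{1..<i}. l < num_arrived N (\<lambda>j. ?x (Inl j)) (?x (Inl a) + (\<Sum>k=1..l. ?x (Inr k)))) \<longleftrightarrow>
          (\<forall>l\<in>{1..<i}. l < ?c l)"
        using i by (intro ball_cong refl) (subst arr, auto)
      moreover have "num_arrived N (\<lambda>j. ?x (Inl j)) (?x (Inl a) + (\<Sum>k=1..i. ?x (Inr k))) = ?c i"
        using i by (intro arr) simp
      ultimately show ?thesis unfolding busy_event_def by simp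
    qed
    finally show "?x \<in> {x \<in> space (clocks ?K). first_busy_served N (\<lambda>j. x (Inl j)) (\<lambda>k. x (Inr k)) = i} \<longleftrightarrow> y \<in> E' m"
      using x y unfolding a(1) Kl E'_def sum.case mem_Collect_eq by blast
  qed (use i in \<open>auto simp: I_def\<close>)
  also have "\<dots> = (\<Sum>m\<in>I. 1 / N * hit N (rho N lam mu) (\<lambda>l. of_bool (l = i)) 0 1)"
  proof (rule sum.cong)
    fix m assume "m \<in> I"
    then obtain a where a: "m = Inl a" "a \<in> {1..N}" by (auto simp: I_def)
    have "N - card ({1..N} - {a}) = 1" using a by (simp add: card_Diff_singleton)
    then have "measure (clocks (?K - {m})) (E' m) = hit N (rho N lam mu) (\<lambda>l. of_bool (l = i)) 0 1"
      using measure_busy_event[of "{1..N} - {a}" 0 i] i unfolding a(1) Kl E'_def sum.case by auto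
    then show "case_sum (\<lambda>_. lam) (\<lambda>_. mu) m / (\<Sum>j\<in>I. case_sum (\<lambda>_. lam) (\<lambda>_. mu) j) * measure (clocks (?K - {m})) (E' m) =
       1 / N * hit N (rho N lam mu) (\<lambda>l. of_bool (l = i)) 0 1"
      unfolding S using a lam by simp
  qed simp
  also have "\<dots> = hit N (rho N lam mu) (\<lambda>l. of_bool (l = i)) 0 1"
    using i by (simp add: I_def card_image)
  finally show ?thesis .
qed

end

section \<open>Transfer to the given probability space\<close>

lemma b_fun_eq_b_powers:
  assumes "lam > 0" "mu > 0" "i < N"
  shows "b_fun (arr_rate N lam) {1..i} (\<lambda>j. rho N lam mu j ^ u j) = b_powers (arr_rate N lam) i u"
proof -
  have "rho N lam mu j ^ u j \<noteq> 1 \<longleftrightarrow> u j \<noteq> 0" if "j \<in> {1..i}" for j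
    using rho_lt_1[of lam mu j N] assms that power_less_one_iff[of "rho N lam mu j" "u j"] by force
  then have "{k \<in> {1..i}. rho N lam mu k ^ u k \<noteq> 1} = {j \<in> {1..i}. u j \<noteq> 0}" by blast
  then show ?thesis by (simp only: b_fun_def b_powers_def)
qed

text \<open>A point of the product space carries the given times only at the indices in
  \<open>{1..N}\<close> and is \<open>undefined\<close> elsewhere, so the functional must be shown
  to ignore other indices.\<close>

lemma first_busy_served_cong:
  assumes T: "\<And>j. j \<in> {1..N} \<Longrightarrow> T j = T' j" and V: "\<And>k. k \<in> {1..N} \<Longrightarrow> V k = V' k"
  shows "first_busy_served N T V = first_busy_served N T' V'"
proof -
  have arr: "arrival_epoch N T = arrival_epoch N T'"
  proof -
    have "map T [1..<Suc N] = map T' [1..<Suc N]" using T by (intro map_cong) auto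
    then show ?thesis by (simp only: arrival_epoch_def fun_eq_iff) simp
  qed
  have num: "num_arrived N T = num_arrived N T'"
    unfolding num_arrived_def fun_eq_iff using T by (auto intro!: arg_cong[where f = card])
  have dep: "departure_epoch N T V k = departure_epoch N T' V' k" if "k \<le> N" for k
    using that by (induction k) (auto simp: arr V)
  have served: "num_served N T V = num_served N T' V'"
    unfolding num_served_def fun_eq_iff using dep by (auto intro!: arg_cong[where f = card])
  have "departure_epoch N T V ` {1..N} = departure_epoch N T' V' ` {1..N}"
    using dep by (intro image_cong) auto
  then show ?thesis
    by (simp only: first_busy_served_def first_busy_end_def num served)
qed

lemma distr_distributed_exponential:
  assumes "distributed P lborel X (exponential_density r)"
  shows "X \<in> borel_measurable P" "distr P borel X = expo r"
proof -
  show "X \<in> borel_measurable P" using distributed_measurable[OF assms] by simp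
  have "distr P borel X = distr P lborel X" by (rule distr_cong) simp_all
  also have "\<dots> = expo r" unfolding expo_def by (rule distributed_distr_eq_density[OF assms])
  finally show "distr P borel X = expo r" .
qed

theorem theorem2p1:
  fixes P :: "'a measure"
    and T V :: "nat \<Rightarrow> 'a \<Rightarrow> real"
    and N i :: nat
    and lam mu :: real
  assumes "N \<ge> 1" and "lam > 0" and "mu > 0"
    and "prob_space P"
    and "\<And>j. j \<in> {1..N} \<Longrightarrow> distributed P lborel (T j) (exponential_density lam)"
    and "\<And>k. k \<in> {1..N} \<Longrightarrow> distributed P lborel (V k) (exponential_density mu)"
    and "prob_space.indep_vars P (\<lambda>_. borel) (case_sum T V) ({1..N} <+> {1..N})"
    and "1 \<le> i" and "i \<le> N"
  defines "s \<equiv> measure P {\<omega> \<in> space P.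
                 first_busy_served N (\<lambda>j. T j \<omega>) (\<lambda>k. V k \<omega>) = i}"
  shows "s = measure_pmf.prob (chain_path N lam mu (2 * N)) {xs. first_return_at i xs}
    \<and> s = (\<Sum>u\<in>feasible_allocations i.
            b_powers (arr_rate N lam) i u * (\<Prod>j=1..i. rho N lam mu j ^ u j))
    \<and> (i < N \<longrightarrow>
        s = (\<Sum>u\<in>feasible_allocations i.
              b_fun (arr_rate N lam) {1..i} (\<lambda>j. rho N lam mu j ^ u j)
                * (\<Prod>j=1..i. rho N lam mu j ^ u j)))"
proof -
  interpret prob_space P by fact
  interpret queue_clocks N lam mu using assms by unfold_locales
  define K :: "(nat + nat) set" where "K = {1..N} <+> {1..N}"
  let ?X = "\<lambda>\<omega>. \<lambda>m\<in>K. case_sum T V m \<omega>"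
  let ?q = "hit N (rho N lam mu) (\<lambda>l. of_bool (l = i)) 0 1"
  note T = distr_distributed_exponential[OF assms(5)] and V = distr_distributed_exponential[OF assms(6)]
  have X: "case_sum T V m \<in> borel_measurable P" "distr P borel (case_sum T V m) = expo (case_sum (\<lambda>_. lam) (\<lambda>_. mu) m)"
    if "m \<in> K" for m
    using that T V by (auto simp: K_def)
  have "K \<noteq> {}" using assms(1) by (auto simp: K_def)
  \<comment> \<open>Independence makes the joint law of all times the product of the marginals; the
    times are bundled into a function restricted to \<open>K\<close> so that they form a point of
    the product space.\<close>
  have "distr P (Pi\<^sub>M K (\<lambda>_. borel)) ?X = Pi\<^sub>M K (\<lambda>m. distr P borel (case_sum T V m))"
    using assms(7) X(1) \<open>K \<noteq> {}\<close> unfolding K_def[symmetric]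
    by (subst indep_vars_iff_distr_eq_PiM'[symmetric]) auto
  also have "\<dots> = clocks K"
    by (rule PiM_cong) (simp_all add: X(2))
  finally have distr: "distr P (Pi\<^sub>M K (\<lambda>_. borel)) ?X = clocks K" .
  have Xm: "?X \<in> measurable P (Pi\<^sub>M K (\<lambda>_. borel))"
    by (rule measurable_restrict) (rule X(1))
  let ?E = "{x \<in> space (clocks K). first_busy_served N (\<lambda>j. x (Inl j)) (\<lambda>k. x (Inr k)) = i}"
  have "?E = (\<lambda>x. first_busy_served N (\<lambda>j. x (Inl j)) (\<lambda>k. x (Inr k))) -` {i} \<inter> space (clocks K)" by auto
  also have "\<dots> \<in> sets (clocks K)"
    by (intro measurable_sets[where A = "count_space UNIV"] measurable_first_busy_served measurable_clock)
      (auto simp: K_def)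
  finally have E: "?E \<in> sets (clocks K)" .
  have "first_busy_served N (\<lambda>j. ?X \<omega> (Inl j)) (\<lambda>k. ?X \<omega> (Inr k)) =
      first_busy_served N (\<lambda>j. T j \<omega>) (\<lambda>k. V k \<omega>)" for \<omega>
    by (rule first_busy_served_cong) (auto simp: K_def)
  then have "?X -` ?E \<inter> space P = {\<omega> \<in> space P. first_busy_served N (\<lambda>j. T j \<omega>) (\<lambda>k. V k \<omega>) = i}"
    by (auto simp: space_PiM)
  then have "s = measure P (?X -` ?E \<inter> space P)" by (simp only: s_def)
  also have "\<dots> = measure (clocks K) ?E"
    using E unfolding distr[symmetric] by (intro measure_distr[symmetric] Xm) simp
  also have "\<dots> = ?q"
    unfolding K_def using assms by (intro measure_first_busy_served) simp
  finally have s: "s = ?q" .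
  have "s = measure_pmf.prob (chain_path N lam mu (2 * N)) {xs. first_return_at i xs}"
    unfolding s by (rule prob_first_return[symmetric]) fact+
  moreover have alloc: "s = (\<Sum>u\<in>feasible_allocations i.
            b_powers (arr_rate N lam) i u * (\<Prod>j=1..i. rho N lam mu j ^ u j))"
    unfolding s using hit_eq_alloc_sum[of lam mu i N] assms by (simp add: alloc_sum_def)
  moreover have "s = (\<Sum>u\<in>feasible_allocations i.
              b_fun (arr_rate N lam) {1..i} (\<lambda>j. rho N lam mu j ^ u j)
                * (\<Prod>j=1..i. rho N lam mu j ^ u j))" if "i < N"
    unfolding b_fun_eq_b_powers[OF assms(2,3) that] by (rule alloc)
  ultimately show ?thesis by blast
qed

end
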